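(* Let $\gamma\ge 0$. There exist constants $C>0$ and $L_0>0$, depending only on $\gamma$, such that for every $L\ge L_0$ and every $2L$-periodic (in $x$) solution $u(x,t)$, $t\ge 0$, of $$u_t=-u_{xxxx}-u_{xx}+\gamma u+u\,u_x$$ with initial data in $L_2([-L,L])$ satisfying $\int_{-L}^{L}u(x,0)\,dx=0$, one has $$\limsup_{t\to\infty}\|u(\cdot,t)\|_2\le C L^{3/2}.$$
   Context: $\|\cdot\|_2$ is the norm of $L_2([-L,L])$. For $\gamma=0$ the equation is the Kuramoto-Sivashinsky equation; for $\gamma>0$ it is the destabilized Kuramoto-Sivashinsky equation. Solutions are $2L$-periodic in $x$; the zero-mean condition is preserved by the flow. *)

theory Defs
  imports "HOL-Analysis.Analysis"
begin

definition in_L2 :: "real \<Rightarrow> (real \<Rightarrow> real) \<Rightarrow> bool" where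
  "in_L2 L f \<longleftrightarrow> set_borel_measurable lebesgue {-L..L} f \<and>
                set_integrable lebesgue {-L..L} (\<lambda>x. (f x)\<^sup>2)"

definition L2_norm :: "real \<Rightarrow> (real \<Rightarrow> real) \<Rightarrow> real" where
  "L2_norm L f = sqrt (LINT x:{-L..L}|lebesgue. (f x)\<^sup>2)"

definition dx :: "nat \<Rightarrow> (real \<Rightarrow> real \<Rightarrow> real) \<Rightarrow> real \<Rightarrow> real \<Rightarrow> real" where
  "dx k u x t = (deriv ^^ k) (\<lambda>y. u y t) x"

definition dt :: "(real \<Rightarrow> real \<Rightarrow> real) \<Rightarrow> real \<Rightarrow> real \<Rightarrow> real" where
  "dt u x t = deriv (\<lambda>s. u x s) t"

text \<open>
  A 2L-periodic solution, written \<open>u x t\<close>, with initial data in \<open>L\<^sub>2\<close>: the equation holds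
  classically for \<open>t > 0\<close> (parabolic smoothing), and the initial value is attained in \<open>L\<^sub>2\<close>.
  Joint continuity of \<open>dt u\<close> is not required since it follows from the equation.  As \<open>deriv\<close> is a
  total function, existence of the derivatives is demanded separately.
\<close>

definition dKS_solution :: "real \<Rightarrow> real \<Rightarrow> (real \<Rightarrow> real \<Rightarrow> real) \<Rightarrow> bool" where
  "dKS_solution \<gamma> L u \<longleftrightarrow>
     (\<forall>t\<ge>0. \<forall>x. u (x + 2 * L) t = u x t) \<and>
     (\<forall>t>0. \<forall>x. \<forall>k<4. (\<lambda>y. dx k u y t) field_differentiable at x) \<and>
     (\<forall>k\<le>4. continuous_on (UNIV \<times> {0<..}) (\<lambda>(x, t). dx k u x t)) \<and>
     (\<forall>t>0. \<forall>x. (\<lambda>s. u x s) field_differentiable at t) \<and>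
     (\<forall>t>0. \<forall>x. dt u x t = - dx 4 u x t - dx 2 u x t + \<gamma> * u x t + u x t * dx 1 u x t) \<and>
     in_L2 L (\<lambda>x. u x 0) \<and>
     ((\<lambda>t. L2_norm L (\<lambda>x. u x t - u x 0)) \<longlongrightarrow> 0) (at_right 0)"

end

theory Submission
  imports Defs
begin

text \<open>
  The proof is a Lyapunov function argument with a background profile.  Fix a \<open>2L\<close>-periodic profile
  \<open>\<phi>\<close> with \<open>\<phi>'/2 = S - \<lambda>\<close>, where \<open>\<lambda> = \<gamma> + 3\<close> and \<open>S\<close> is supported in a
  short interval \<open>[-w, w]\<close>; periodicity forces \<open>\<integral> S = 2 \<lambda> L\<close>.  For a translate
  \<open>v = u(\<cdot> + s, t)\<close> of a solution, with \<open>s\<close> held fixed,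
  \<open>d/dt \<integral> (v - \<phi>)^2\<close> contains the term \<open>-2 \<integral> \<phi> v v' = \<integral> \<phi>' v^2\<close>.  Its part
  \<open>-2 \<lambda> \<integral> v^2\<close> damps everything that \<open>-v''\<close> and \<open>\<gamma> v\<close> can produce.  The price is the
  spike term \<open>2 \<integral> S v^2\<close>, whose mass is of order \<open>L\<close>.

  The spike is paid for in two ways.  At every time \<open>s\<close> is chosen so as to minimise
  \<open>\<integral> (v - \<phi>)^2\<close>; stationarity in \<open>s\<close> and the zero mean of \<open>v\<close> give \<open>\<integral> S v = 0\<close>, which
  removes the constant part of \<open>v\<close> near the spike.  Moreover \<open>S\<close> is even and has a
  \<^emph>\<open>negative\<close> second moment, so that the linear part of \<open>v\<close> contributes with the favourable
  sign, and what remains is a second order Taylor remainder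
  (lemma \<open>bump_form_le\<close>): \<open>\<integral> S v^2\<close> is at most a constant times
  \<open>\<lambda> L w^3 \<integral> v''^2\<close>.  Taking \<open>w^3\<close> to be a small multiple of \<open>1 / (\<lambda> L)\<close> lets the fourth order
  dissipation absorb it.

  Consequently the minimal gap \<open>min over s of \<integral> (v - \<phi>)^2\<close> decays exponentially up to an error
  of size \<open>\<integral> \<phi>^2 + \<integral> \<phi>''^2\<close> (lemma \<open>energy_rate_le\<close>).  Here \<open>\<phi>\<close> is bounded by a multiple of
  \<open>L\<close>, so \<open>\<integral> \<phi>^2\<close> is of order \<open>L^3\<close>, while \<open>\<integral> \<phi>''^2\<close> is of order
  \<open>w (L / w^2)^2 = L^2 / w^3\<close>, again of order \<open>L^3\<close> (lemma \<open>background_profile\<close>).  This is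
  exactly the square of \<open>L^(3/2)\<close>.  The minimum over \<open>s\<close> need not be differentiable in \<open>t\<close>, and
  \<open>envelope_comparison\<close> replaces Gronwall's lemma.
\<close>

section \<open>Calculus on an interval\<close>

lemma integral_parts_periodic:
  fixes f g f' g' :: "real \<Rightarrow> real"
  assumes "a \<le> b"
    and f: "\<And>x. x \<in> {a..b} \<Longrightarrow> (f has_real_derivative f' x) (at x within {a..b})"
    and g: "\<And>x. x \<in> {a..b} \<Longrightarrow> (g has_real_derivative g' x) (at x within {a..b})"
    and cf: "continuous_on {a..b} f'" and cg: "continuous_on {a..b} g'"
    and bd: "f b * g b = f a * g a"
  shows "integral {a..b} (\<lambda>x. f' x * g x) = - integral {a..b} (\<lambda>x. f x * g' x)"
proof -
  have cf0: "continuous_on {a..b} f" and cg0: "continuous_on {a..b} g"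
    by (rule DERIV_continuous_on, erule f, rule DERIV_continuous_on, erule g)
  have "((\<lambda>x. f' x * g x + f x * g' x) has_integral (f b * g b - f a * g a)) {a..b}"
  proof (rule fundamental_theorem_of_calculus[OF \<open>a \<le> b\<close>])
    fix x assume x: "x \<in> {a..b}"
    have "((\<lambda>x. f x * g x) has_real_derivative (f' x * g x + f x * g' x)) (at x within {a..b})"
      by (rule derivative_eq_intros f[OF x] g[OF x] | simp)+
    then show "((\<lambda>x. f x * g x) has_vector_derivative f' x * g x + f x * g' x) (at x within {a..b})"
      by (simp add: has_real_derivative_iff_has_vector_derivative)
  qed
  then have "integral {a..b} (\<lambda>x. f' x * g x + f x * g' x) = 0"
    using bd by (simp add: integral_unique)
  moreover have "integral {a..b} (\<lambda>x. f' x * g x + f x * g' x)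
      = integral {a..b} (\<lambda>x. f' x * g x) + integral {a..b} (\<lambda>x. f x * g' x)"
    by (intro integral_add integrable_continuous_real continuous_intros cf cg cf0 cg0)
  ultimately show ?thesis by simp
qed

lemma integral_deriv_periodic:
  fixes f f' :: "real \<Rightarrow> real"
  assumes "a \<le> b"
    and f: "\<And>x. x \<in> {a..b} \<Longrightarrow> (f has_real_derivative f' x) (at x within {a..b})"
    and cf: "continuous_on {a..b} f'"
    and bd: "f b = f a"
  shows "integral {a..b} f' = 0"
  using integral_parts_periodic[OF \<open>a \<le> b\<close> f, of "\<lambda>_. 1" "\<lambda>_. 0"] cf bd by simp

text \<open>The Cauchy-Schwarz inequality for \<open>g b - g a = \<integral> g'\<close>, obtained by comparing \<open>g'\<close> with its mean slope.\<close>

lemma increment_sq_le: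
  fixes g g' :: "real \<Rightarrow> real"
  assumes "a \<le> b"
    and g: "\<And>x. x \<in> {a..b} \<Longrightarrow> (g has_real_derivative g' x) (at x)"
    and cg: "continuous_on {a..b} g'"
  shows "(g b - g a)\<^sup>2 \<le> (b - a) * integral {a..b} (\<lambda>x. (g' x)\<^sup>2)"
proof (cases "a = b")
  case False
  then have ab: "a < b" using assms by simp
  define m where "m = (g b - g a) / (b - a)"
  have m: "g b - g a = m * (b - a)" using ab by (simp add: m_def)
  have "(g' has_integral (g b - g a)) {a..b}"
    by (rule fundamental_theorem_of_calculus[OF \<open>a \<le> b\<close>])
      (use g in \<open>auto simp: has_real_derivative_iff_has_vector_derivative has_vector_derivative_at_within\<close>)
  then have I: "((\<lambda>x. 2 * m * g' x - m\<^sup>2) has_integral (2 * m * (g b - g a) - (b - a) * m\<^sup>2)) {a..b}"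
    using has_integral_const_real[of "m\<^sup>2" a b] ab
    by (intro has_integral_diff has_integral_mult_right) auto
  have "2 * m * (g b - g a) - (b - a) * m\<^sup>2 \<le> integral {a..b} (\<lambda>x. (g' x)\<^sup>2)"
  proof (rule has_integral_le[OF I integrable_integral])
    show "(\<lambda>x. (g' x)\<^sup>2) integrable_on {a..b}"
      by (intro integrable_continuous_real continuous_intros cg)
    show "2 * m * g' x - m\<^sup>2 \<le> (g' x)\<^sup>2" for x
      using zero_le_power2[of "g' x - m"] by (simp add: power2_diff mult_ac)
  qed
  then have "(b - a) * m\<^sup>2 \<le> integral {a..b} (\<lambda>x. (g' x)\<^sup>2)"
    unfolding m by (simp add: power2_eq_square algebra_simps)
  then have "(b - a) * ((b - a) * m\<^sup>2) \<le> (b - a) * integral {a..b} (\<lambda>x. (g' x)\<^sup>2)"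
    using ab by (intro mult_left_mono) auto
  then show ?thesis unfolding m by (simp add: power2_eq_square algebra_simps)
qed simp

lemma DERIV_integral_param:
  fixes f f' :: "real \<Rightarrow> real \<Rightarrow> real"
  assumes U: "open U" "convex U" "t \<in> U"
    and f: "\<And>t x. t \<in> U \<Longrightarrow> x \<in> {a..b} \<Longrightarrow> ((\<lambda>t. f t x) has_real_derivative f' t x) (at t)"
    and cf: "\<And>t. t \<in> U \<Longrightarrow> continuous_on {a..b} (f t)"
    and cf': "continuous_on (U \<times> {a..b}) (\<lambda>(t, x). f' t x)"
  shows "((\<lambda>t. integral {a..b} (f t)) has_real_derivative integral {a..b} (f' t)) (at t)"
proof -
  have "((\<lambda>t. integral (cbox a b) (f t)) has_real_derivative integral (cbox a b) (f' t)) (at t within U)"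
  proof (rule leibniz_rule_field_derivative)
    show "((\<lambda>t. f t x) has_real_derivative f' t x) (at t within U)"
      if "t \<in> U" "x \<in> cbox a b" for t x
      using f[OF that(1)] that(2) by (simp add: has_field_derivative_at_within)
    show "f t integrable_on cbox a b" if "t \<in> U" for t
      using integrable_continuous_real[OF cf[OF that]] by simp
  qed (use cf' U in simp_all)
  then show ?thesis unfolding at_within_open[OF U(3) U(1)] box_real .
qed

text \<open>Differentiating in \<open>s\<close> leaves the boundary values of \<open>g\<close>, which cancel by periodicity.\<close>

lemma integral_periodic_shift:
  fixes g g' :: "real \<Rightarrow> real"
  assumes per: "\<And>x. g (x + 2 * L) = g x" and "L \<ge> 0"
    and g: "\<And>x. (g has_real_derivative g' x) (at x)" and cg': "continuous_on UNIV g'"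
  shows "integral {-L..L} (\<lambda>x. g (x + s)) = integral {-L..L} g"
proof -
  have cg: "continuous_on A g" for A
    using g by (meson DERIV_isCont continuous_at_imp_continuous_on)
  have "((\<lambda>s. integral {-L..L} (\<lambda>x. g (x + s))) has_real_derivative 0) (at s)" for s
  proof -
    have g_shift: "((\<lambda>x. g (x + s)) has_real_derivative g' (x + s)) (at x)" for x s
      using g[of "x + s"] by (simp add: DERIV_shift)
    have "((\<lambda>s. integral {-L..L} (\<lambda>x. g (x + s))) has_real_derivative
        integral {-L..L} (\<lambda>x. g' (x + s))) (at s)"
    proof (rule DERIV_integral_param[where U = UNIV])
      show "((\<lambda>s. g (x + s)) has_real_derivative g' (x + s)) (at s)" for x s
        using g_shift[of x s] by (simp add: add.commute)
      show "continuous_on (UNIV \<times> {-L..L}) (\<lambda>(s, x). g' (x + s))"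
        unfolding case_prod_beta
        by (intro continuous_on_compose2[OF cg'] continuous_intros) auto
    qed (auto intro!: continuous_on_compose2[OF cg[of UNIV]] continuous_intros)
    moreover have "integral {-L..L} (\<lambda>x. g' (x + s)) = 0"
    proof (rule integral_deriv_periodic)
      show "g (L + s) = g (- L + s)" using per[of "- L + s"] by (simp add: algebra_simps)
    qed (use \<open>L \<ge> 0\<close> in \<open>auto intro!: has_field_derivative_at_within g_shift
        continuous_on_compose2[OF cg'] continuous_intros\<close>)
    ultimately show ?thesis by simp
  qed
  then have "integral {-L..L} (\<lambda>x. g (x + s)) = integral {-L..L} (\<lambda>x. g (x + 0))"
    using DERIV_isconst_all by blast
  then show ?thesis by simp
qed

text \<open>The Cauchy-Schwarz inequality against the constant function; as above, it is the nonnegativity of the variance.\<close>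

lemma set_integral_power2_le:
  fixes f :: "real \<Rightarrow> real"
  assumes "L > 0"
    and f: "set_integrable lebesgue {-L..L} f" and f2: "set_integrable lebesgue {-L..L} (\<lambda>x. (f x)\<^sup>2)"
  shows "(LINT x:{-L..L}|lebesgue. f x)\<^sup>2 \<le> 2 * L * (LINT x:{-L..L}|lebesgue. (f x)\<^sup>2)"
proof -
  define I where "I = (LINT x:{-L..L}|lebesgue. f x)"
  define m where "m = I / (2 * L)"
  have c: "set_integrable lebesgue {-L..L} (\<lambda>x. m\<^sup>2)"
    by (intro absolutely_integrable_continuous_real continuous_intros)
  have mf: "set_integrable lebesgue {-L..L} (\<lambda>x. 2 * m * f x)"
    using f by (intro set_integrable_mult_right) auto
  have "2 * m * I - m\<^sup>2 * (2 * L) = (LINT x:{-L..L}|lebesgue. 2 * m * f x - m\<^sup>2)"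
    using set_lebesgue_integral_eq_integral(2)[OF c] \<open>L > 0\<close>
    by (simp add: set_integral_diff(2)[OF mf c] I_def)
  also have "\<dots> \<le> (LINT x:{-L..L}|lebesgue. (f x)\<^sup>2)"
  proof (rule set_integral_mono[OF set_integral_diff(1)[OF mf c] f2])
    show "2 * m * f x - m\<^sup>2 \<le> (f x)\<^sup>2" for x
      using zero_le_power2[of "f x - m"] by (simp add: power2_diff mult_ac)
  qed
  finally have "2 * L * (2 * m * I - m\<^sup>2 * (2 * L)) \<le> 2 * L * (LINT x:{-L..L}|lebesgue. (f x)\<^sup>2)"
    using \<open>L > 0\<close> by (intro mult_left_mono) auto
  moreover have "2 * L * (2 * m * I - m\<^sup>2 * (2 * L)) = I\<^sup>2"
    using \<open>L > 0\<close> by (simp add: m_def field_simps power2_eq_square)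
  ultimately show ?thesis by (simp add: I_def)
qed

lemma periodic_representative:
  fixes h :: "real \<Rightarrow> 'a"
  assumes "p > 0" and "\<And>s. h (s + p) = h s"
  shows "\<exists>s'\<in>{0..p}. h s' = h s"
proof -
  interpret periodic_fun_simple h p by standard (rule assms)
  define s' where "s' = s + of_int (- \<lfloor>s / p\<rfloor>) * p"
  have "s' = p * frac (s / p)" using \<open>p > 0\<close> by (simp add: s'_def frac_def field_simps)
  moreover have "0 \<le> frac (s / p)" "frac (s / p) \<le> 1" by (simp_all add: frac_lt_1 less_imp_le)
  ultimately have "s' \<in> {0..p}"
    using \<open>p > 0\<close> mult_left_mono[of "frac (s / p)" 1 p] by simp
  moreover have "h s' = h s" unfolding s'_def by (rule plus_of_int)
  ultimately show ?thesis by blast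
qed

section \<open>A compactly supported bump with negative second moment\<close>

text \<open>The squared positive part makes a polynomial cut off at its zeros continuously differentiable, which is the regularity that \<open>\<phi>''\<close> needs.\<close>

lemma DERIV_max0_sq: "((\<lambda>z::real. (max 0 z)\<^sup>2) has_real_derivative 2 * max 0 z) (at z)"
proof -
  consider "z > 0" | "z < 0" | "z = 0" by linarith
  then show ?thesis
  proof cases
    case 1
    have "((\<lambda>z::real. z\<^sup>2) has_real_derivative 2 * max 0 z) (at z)"
      using 1 by (auto intro!: derivative_eq_intros)
    then show ?thesis
      by (rule has_field_derivative_transform_within_open[where S="{0<..}"]) (use 1 in auto)
  next
    case 2
    have "((\<lambda>z::real. 0) has_real_derivative 2 * max 0 z) (at z)"
      using 2 by (auto intro!: derivative_eq_intros)
    then show ?thesis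
      by (rule has_field_derivative_transform_within_open[where S="{..<0}"]) (use 2 in auto)
  next
    case 3
    have "((\<lambda>h::real. (max 0 h)\<^sup>2 / h) \<longlongrightarrow> 0) (at 0)"
    proof (rule Lim_null_comparison[OF _ tendsto_rabs_zero[OF tendsto_ident_at]])
      show "\<forall>\<^sub>F h in at 0. norm ((max 0 h)\<^sup>2 / h) \<le> \<bar>h::real\<bar>"
        by (rule always_eventually) (auto simp: max_def power2_eq_square)
    qed
    then show ?thesis using 3 by (simp add: DERIV_def)
  qed
qed

text \<open>
  Among the even functions \<open>(1 - y^2)^2 (\<alpha> - \<beta> y^2)\<close> on \<open>[-1, 1]\<close>, the coefficients are
  determined by mass \<open>1\<close> and second moment \<open>-1/7\<close>.
\<close>

definition bump :: "real \<Rightarrow> real" where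
  "bump y = 15/32 * ((max 0 (1 - y\<^sup>2))\<^sup>2 * (5 - 21 * y\<^sup>2))"

definition bump' :: "real \<Rightarrow> real" where
  "bump' y = 15/32 * (2 * max 0 (1 - y\<^sup>2) * (- 2 * y) * (5 - 21 * y\<^sup>2) + (max 0 (1 - y\<^sup>2))\<^sup>2 * (- 42 * y))"

lemma bump_deriv: "(bump has_real_derivative bump' y) (at y)"
  unfolding bump_def[abs_def] bump'_def
  by (rule derivative_eq_intros DERIV_chain2[OF DERIV_max0_sq] refl | simp)+

lemma continuous_bump [continuous_intros]: "continuous_on A f \<Longrightarrow> continuous_on A (\<lambda>x. bump (f x))"
  unfolding bump_def by (intro continuous_intros)

lemma continuous_bump' [continuous_intros]: "continuous_on A f \<Longrightarrow> continuous_on A (\<lambda>x. bump' (f x))"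
  unfolding bump'_def by (intro continuous_intros)

lemma bump_outside:
  assumes "\<bar>y\<bar> \<ge> 1" shows "bump y = 0" "bump' y = 0"
proof -
  have "1\<^sup>2 \<le> \<bar>y\<bar>\<^sup>2" using assms by (intro power_mono) auto
  then have "max 0 (1 - y\<^sup>2) = 0" by simp
  then show "bump y = 0" "bump' y = 0" by (simp_all add: bump_def bump'_def)
qed

lemma bump_bounds: "\<bar>bump y\<bar> \<le> 15/2" "\<bar>bump' y\<bar> \<le> 50"
proof -
  have "\<bar>bump y\<bar> \<le> 15/2 \<and> \<bar>bump' y\<bar> \<le> 50"
  proof (cases "\<bar>y\<bar> \<ge> 1")
    case False
    then have y: "\<bar>y\<bar> \<le> 1" and y2: "y\<^sup>2 \<le> 1" by (auto simp: abs_square_le_1)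
    define p where "p = max 0 (1 - y\<^sup>2)"
    have p: "\<bar>p\<bar> \<le> 1" "\<bar>p\<^sup>2\<bar> \<le> 1" by (auto simp: p_def max_def power_le_one y2)
    have h: "\<bar>5 - 21 * y\<^sup>2\<bar> \<le> 16" using y2 zero_le_power2[of y] by linarith
    define A B C where "A = p\<^sup>2 * (5 - 21 * y\<^sup>2)" and "B = p * y * (5 - 21 * y\<^sup>2)" and "C = p\<^sup>2 * y"
    have A: "\<bar>A\<bar> \<le> 1 * 16"
      unfolding abs_mult A_def by (intro mult_mono p h) auto
    have B: "\<bar>B\<bar> \<le> 1 * 1 * 16"
      unfolding abs_mult B_def by (intro mult_mono p h y) auto
    have C: "\<bar>C\<bar> \<le> 1 * 1"
      unfolding abs_mult C_def by (intro mult_mono p h y) auto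
    have "bump y = 15/32 * A"
      by (auto simp: bump_def p_def A_def)
    then have "\<bar>bump y\<bar> \<le> 15/2" using A by linarith
    moreover have "bump' y = 15/32 * (- 4 * B - 42 * C)"
      by (auto simp: bump'_def p_def B_def C_def algebra_simps)
    then have "\<bar>bump' y\<bar> \<le> 50" using B C unfolding abs_le_iff by (simp add: field_simps)
    ultimately show ?thesis ..
  qed (simp add: bump_outside)
  then show "\<bar>bump y\<bar> \<le> 15/2" "\<bar>bump' y\<bar> \<le> 50" by auto
qed

lemma bump_poly:
  assumes "\<bar>y\<bar> \<le> 1"
  shows "bump y = 15/32 * (5 - 31 * y^2 + 47 * y^4 - 21 * y^6)"
proof -
  have "max 0 (1 - y\<^sup>2) = 1 - y\<^sup>2" using assms by (simp add: abs_square_le_1)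
  then show ?thesis by (simp add: bump_def power_numeral_reduce algebra_simps)
qed

lemma bump_moments:
  assumes w: "w > 0"
  shows "((\<lambda>x. bump (x / w)) has_integral w) {-w..w}"
    and "((\<lambda>x. bump (x / w) * x) has_integral 0) {-w..w}"
    and "((\<lambda>x. bump (x / w) * x\<^sup>2) has_integral - (w ^ 3 / 7)) {-w..w}"
proof -
  have y: "\<bar>x / w\<bar> \<le> 1" if "x \<in> {-w..w}" for x using that w by (auto simp: abs_le_iff field_simps)
  have *: "((\<lambda>x. bump (x / w) * x ^ j) has_integral (w ^ Suc j * (P 1 - P (-1)))) {-w..w}"
    if P: "\<And>y. (P has_real_derivative 15/32 * (5 - 31 * y^2 + 47 * y^4 - 21 * y^6) * y ^ j) (at y)"
    for P :: "real \<Rightarrow> real" and j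
  proof -
    have "((\<lambda>x. bump (x / w) * x ^ j) has_integral (w ^ Suc j * P (w / w) - w ^ Suc j * P (- w / w))) {-w..w}"
    proof (rule fundamental_theorem_of_calculus)
      fix x assume x: "x \<in> {-w..w}"
      have "((\<lambda>x. w ^ Suc j * P (x / w)) has_real_derivative
          w ^ Suc j * (bump (x / w) * (x / w) ^ j * (1 / w))) (at x)"
        unfolding bump_poly[OF y[OF x]]
        by (intro DERIV_cmult DERIV_chain2[OF P] DERIV_cdivide DERIV_ident)
      also have "w ^ Suc j * (bump (x / w) * (x / w) ^ j * (1 / w)) = bump (x / w) * x ^ j"
        using w by (simp add: power_divide)
      finally show "((\<lambda>x. w ^ Suc j * P (x / w)) has_vector_derivative bump (x / w) * x ^ j)
          (at x within {-w..w})"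
        by (simp add: has_real_derivative_iff_has_vector_derivative has_vector_derivative_at_within)
    qed (use w in simp)
    then show ?thesis using w by (simp add: algebra_simps)
  qed
  have "((\<lambda>y. 15/32 * (5 * y - 31/3 * y^3 + 47/5 * y^5 - 3 * y^7)) has_real_derivative
      15/32 * (5 - 31 * y^2 + 47 * y^4 - 21 * y^6) * y ^ 0) (at y)" for y :: real
    by (rule derivative_eq_intros refl | simp)+
  from *[OF this] show "((\<lambda>x. bump (x / w)) has_integral w) {-w..w}" by simp
  have "((\<lambda>y. 15/32 * (5/2 * y^2 - 31/4 * y^4 + 47/6 * y^6 - 21/8 * y^8)) has_real_derivative
      15/32 * (5 - 31 * y^2 + 47 * y^4 - 21 * y^6) * y ^ 1) (at y)" for y :: real
    by (rule derivative_eq_intros refl | simp add: algebra_simps power_numeral_reduce)+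
  from *[OF this] show "((\<lambda>x. bump (x / w) * x) has_integral 0) {-w..w}" by simp
  have "((\<lambda>y. 15/32 * (5/3 * y^3 - 31/5 * y^5 + 47/7 * y^7 - 21/9 * y^9)) has_real_derivative
      15/32 * (5 - 31 * y^2 + 47 * y^4 - 21 * y^6) * y ^ 2) (at y)" for y :: real
    by (rule derivative_eq_intros refl | simp add: algebra_simps power_numeral_reduce)+
  from *[OF this] show "((\<lambda>x. bump (x / w) * x\<^sup>2) has_integral - (w ^ 3 / 7)) {-w..w}"
    by (simp add: eval_nat_numeral)
qed

lemma integral_le_const:
  fixes f :: "real \<Rightarrow> real"
  assumes "w \<ge> 0" and "continuous_on {-w..w} f" and "\<And>x. x \<in> {-w..w} \<Longrightarrow> f x \<le> c"
  shows "integral {-w..w} f \<le> 2 * w * c"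
  using has_integral_le[OF integrable_integral[OF integrable_continuous_real[OF assms(2)]]
      has_integral_const_real assms(3)] assms(1) by simp

text \<open>
  Write \<open>v = v(0) + a x + r\<close> with \<open>a = v'(0)\<close>.  Since \<open>v\<close> is orthogonal to the bump, \<open>v^2\<close>
  may be replaced by \<open>v^2 - 2 v(0) v = - v(0)^2 + a^2 x^2 + r^2 + 2 a x r\<close>.  The first two terms
  integrate to something nonpositive because the mass is positive and the second moment negative; the
  amount gained from \<open>a^2 x^2\<close> absorbs the cross term \<open>2 a x r\<close>.  Only \<open>r^2\<close> survives, and
  \<open>\<bar>r\<bar> \<le> \<rho>\<close> with \<open>\<rho>^2 = w^3 \<integral> v''^2\<close>.
\<close>

lemma bump_form_le:
  fixes v v1 v2 :: "real \<Rightarrow> real"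
  assumes w: "w > 0"
    and v: "\<And>x. (v has_real_derivative v1 x) (at x)"
    and v1: "\<And>x. (v1 has_real_derivative v2 x) (at x)"
    and cv2: "continuous_on {-w..w} v2"
    and orth: "integral {-w..w} (\<lambda>x. bump (x / w) * v x) = 0"
  shows "integral {-w..w} (\<lambda>x. bump (x / w) * (v x)\<^sup>2)
    \<le> 1590 * w ^ 4 * integral {-w..w} (\<lambda>x. (v2 x)\<^sup>2)"
proof -
  define X where "X = integral {-w..w} (\<lambda>x. (v2 x)\<^sup>2)"
  define \<rho> where "\<rho> = sqrt (w ^ 3 * X)"
  define a where "a = v1 0"
  define r where "r x = v x - v 0 - a * x" for x
  have iX: "(\<lambda>x. (v2 x)\<^sup>2) integrable_on {-w..w}"
    by (intro integrable_continuous_real continuous_intros cv2)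
  have X0: "X \<ge> 0" unfolding X_def by (rule integral_nonneg[OF iX]) simp
  have \<rho>: "\<rho> \<ge> 0" "\<rho>\<^sup>2 = w ^ 3 * X" using X0 w by (auto simp: \<rho>_def)
  have cv: "continuous_on A v" for A
    using v by (meson DERIV_isCont continuous_at_imp_continuous_on)
  have incr: "(v1 y - v1 x)\<^sup>2 \<le> w * X" if "-w \<le> x" "x \<le> y" "y \<le> w" "y - x \<le> w" for x y
  proof -
    have c: "continuous_on {x..y} v2" by (rule continuous_on_subset[OF cv2]) (use that in auto)
    have "(v1 y - v1 x)\<^sup>2 \<le> (y - x) * integral {x..y} (\<lambda>x. (v2 x)\<^sup>2)"
      by (rule increment_sq_le) (use that v1 c in auto)
    also have "\<dots> \<le> w * X"
    proof (rule mult_mono)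
      show "integral {x..y} (\<lambda>x. (v2 x)\<^sup>2) \<le> X" unfolding X_def
        by (rule integral_subset_le[OF _ _ iX])
          (use that c in \<open>auto intro!: integrable_continuous_real continuous_intros\<close>)
    qed (use that w in \<open>auto intro!: integral_nonneg integrable_continuous_real continuous_intros c\<close>)
    finally show ?thesis .
  qed
  have r_le: "\<bar>r x\<bar> \<le> \<rho>" if x: "x \<in> {-w..w}" for x
  proof -
    have "\<exists>\<xi>. \<bar>\<xi>\<bar> \<le> w \<and> v x - v 0 = x * v1 \<xi>"
    proof (cases x "0::real" rule: linorder_cases)
      case less
      then obtain z where "x < z" "z < 0" "v 0 - v x = (0 - x) * v1 z"
        using MVT2[OF less, of v v1] v by blast
      then show ?thesis using x by (intro exI[of _ z]) auto
    next
      case greater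
      then obtain z where "0 < z" "z < x" "v x - v 0 = (x - 0) * v1 z"
        using MVT2[OF greater, of v v1] v by blast
      then show ?thesis using x by (intro exI[of _ z]) auto
    qed (use w in \<open>auto intro!: exI[of _ 0]\<close>)
    then obtain \<xi> where \<xi>: "\<bar>\<xi>\<bar> \<le> w" "v x - v 0 = x * v1 \<xi>" by blast
    have "(v1 \<xi> - a)\<^sup>2 \<le> w * X"
      using incr[of 0 \<xi>] incr[of \<xi> 0] \<xi>(1) w unfolding a_def
      by (cases "\<xi> \<ge> 0") (auto simp: power2_commute)
    moreover have "x\<^sup>2 \<le> w\<^sup>2" using x by (intro abs_le_square_iff[THEN iffD1]) auto
    ultimately have "x\<^sup>2 * (v1 \<xi> - a)\<^sup>2 \<le> w\<^sup>2 * (w * X)" by (intro mult_mono) auto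
    also have "x\<^sup>2 * (v1 \<xi> - a)\<^sup>2 = (r x)\<^sup>2" unfolding r_def \<xi>(2)
      by (simp add: power2_eq_square algebra_simps)
    also have "w\<^sup>2 * (w * X) = \<rho>\<^sup>2" unfolding \<rho>(2) by (simp add: eval_nat_numeral)
    finally show ?thesis using \<rho>(1) by (simp add: abs_le_square_iff[symmetric])
  qed
  define h where "h x = bump (x / w) * ((r x)\<^sup>2 + 2 * a * x * r x)" for x
  have ch: "continuous_on {-w..w} h" unfolding h_def r_def
    by (intro continuous_intros cv) (use w in auto)
  have h_le: "h x \<le> 15/2 * (\<rho>\<^sup>2 + 2 * (\<bar>a\<bar> * w * \<rho>))" if x: "x \<in> {-w..w}" for x
  proof -
    have "\<bar>(r x)\<^sup>2\<bar> \<le> \<rho>\<^sup>2" using r_le[OF x] \<rho>(1) by (simp add: abs_le_square_iff[symmetric])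
    moreover have "\<bar>a * x * r x\<bar> \<le> \<bar>a\<bar> * w * \<rho>"
      unfolding abs_mult by (intro mult_mono r_le x) (use x w in auto)
    ultimately have "\<bar>(r x)\<^sup>2 + 2 * a * x * r x\<bar> \<le> \<rho>\<^sup>2 + 2 * (\<bar>a\<bar> * w * \<rho>)" by linarith
    then have "\<bar>h x\<bar> \<le> 15/2 * (\<rho>\<^sup>2 + 2 * (\<bar>a\<bar> * w * \<rho>))"
      unfolding h_def abs_mult by (intro mult_mono bump_bounds) auto
    then show ?thesis by simp
  qed
  have "integral {-w..w} h \<le> 2 * w * (15/2 * (\<rho>\<^sup>2 + 2 * (\<bar>a\<bar> * w * \<rho>)))"
    by (rule integral_le_const[OF _ ch h_le]) (use w in simp)
  also have "\<dots> = w * (15 * \<rho>\<^sup>2 + 30 * (\<bar>a\<bar> * w) * \<rho>)" by (simp add: algebra_simps)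
  also have "\<dots> \<le> w * (1590 * \<rho>\<^sup>2 + (\<bar>a\<bar> * w)\<^sup>2 / 7)"
  proof (rule mult_left_mono)
    \<comment> \<open>\<open>1/7\<close> is the second moment of the bump, and \<open>1590 = 15 + 105^2 / 7\<close>.\<close>
    have "0 \<le> (\<bar>a\<bar> * w - 105 * \<rho>)\<^sup>2 / 7" by simp
    then show "15 * \<rho>\<^sup>2 + 30 * (\<bar>a\<bar> * w) * \<rho> \<le> 1590 * \<rho>\<^sup>2 + (\<bar>a\<bar> * w)\<^sup>2 / 7"
      by (simp add: power2_diff power_mult_distrib field_simps)
  qed (use w in simp)
  finally have Ih: "integral {-w..w} h \<le> 1590 * w * \<rho>\<^sup>2 + a\<^sup>2 * w ^ 3 / 7"
    by (simp add: power_mult_distrib eval_nat_numeral algebra_simps)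
  have bv: "((\<lambda>x. bump (x / w) * v x) has_integral 0) {-w..w}"
    unfolding orth[symmetric]
    by (intro integrable_integral integrable_continuous_real continuous_intros cv) (use w in auto)
  have "((\<lambda>x. 2 * v 0 * (bump (x / w) * v x) - (v 0)\<^sup>2 * bump (x / w)
        + a\<^sup>2 * (bump (x / w) * x\<^sup>2) + h x) has_integral
      (2 * v 0 * 0 - (v 0)\<^sup>2 * w + a\<^sup>2 * - (w ^ 3 / 7) + integral {-w..w} h)) {-w..w}"
    by (intro has_integral_add has_integral_diff has_integral_mult_right bump_moments[OF w] bv
        integrable_integral integrable_continuous_real ch)
  moreover have "2 * v 0 * (bump (x / w) * v x) - (v 0)\<^sup>2 * bump (x / w)
        + a\<^sup>2 * (bump (x / w) * x\<^sup>2) + h x = bump (x / w) * (v x)\<^sup>2" for x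
    unfolding h_def r_def by (simp add: power2_eq_square algebra_simps)
  ultimately have "integral {-w..w} (\<lambda>x. bump (x / w) * (v x)\<^sup>2)
      = - ((v 0)\<^sup>2 * w) - a\<^sup>2 * w ^ 3 / 7 + integral {-w..w} h"
    by (simp add: integral_unique)
  also have "\<dots> \<le> 1590 * w * \<rho>\<^sup>2" using Ih mult_nonneg_nonneg[OF zero_le_power2[of "v 0"], of w] w by linarith
  also have "\<dots> = 1590 * w ^ 4 * X" unfolding \<rho>(2) by (simp add: eval_nat_numeral)
  finally show ?thesis unfolding X_def .
qed

section \<open>The background profile\<close>

lemma integral_extend_zero:
  fixes f :: "real \<Rightarrow> real"
  assumes "w \<le> L" and "f integrable_on {-w..w}" and "\<And>x. \<bar>x\<bar> \<ge> w \<Longrightarrow> f x = 0"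
  shows "(f has_integral integral {-w..w} f) {-L..L}"
  by (rule has_integral_on_superset[OF integrable_integral[OF assms(2)]])
    (use assms in \<open>auto simp: abs_le_iff not_le intro!: assms(3)\<close>)

text \<open>
  The profile is the primitive of \<open>\<psi> = 2 (S - l)\<close>, where \<open>S\<close> is the bump rescaled to width \<open>w\<close>
  and mass \<open>2 l L\<close>.  The width is the largest one allowed by the coercivity estimate, because the
  bound on \<open>\<phi>''\<close> deteriorates as \<open>w\<close> shrinks.  It suffices to have \<open>\<phi>\<close> on one period
  with matching boundary values, as solutions are translated instead of the profile.
\<close>

lemma background_profile:
  fixes l L :: real
  assumes l: "l \<ge> 1" and L: "L \<ge> 1"
  obtains \<phi> \<phi>1 \<phi>2 :: "real \<Rightarrow> real" where
    "\<And>x. x \<in> {-L..L} \<Longrightarrow> (\<phi> has_real_derivative \<phi>1 x) (at x within {-L..L})"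
    and "\<And>x. x \<in> {-L..L} \<Longrightarrow> (\<phi>1 has_real_derivative \<phi>2 x) (at x within {-L..L})"
    and "continuous_on {-L..L} \<phi>2"
    and "\<phi> L = \<phi> (-L)" "\<phi>1 L = \<phi>1 (-L)"
    and "integral {-L..L} (\<lambda>x. (\<phi> x)\<^sup>2) \<le> 8192 * l\<^sup>2 * L ^ 3"
    and "integral {-L..L} (\<lambda>x. (\<phi>2 x)\<^sup>2) \<le> 1017600000 * l ^ 3 * L ^ 3"
    and "\<And>v v1 v2. \<lbrakk>\<And>x. (v has_real_derivative v1 x) (at x); \<And>x. (v1 has_real_derivative v2 x) (at x);
      continuous_on {-L..L} v2; integral {-L..L} v = 0; integral {-L..L} (\<lambda>x. \<phi>1 x * v x) = 0\<rbrakk>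
      \<Longrightarrow> 1/2 * integral {-L..L} (\<lambda>x. \<phi>1 x * (v x)\<^sup>2)
        \<le> - l * integral {-L..L} (\<lambda>x. (v x)\<^sup>2) + 1/4 * integral {-L..L} (\<lambda>x. (v2 x)\<^sup>2)"
proof -
  \<comment> \<open>\<open>12720 = 8 * 1590\<close> turns the constant of \<open>bump_form_le\<close>, multiplied by the mass \<open>2 l L\<close>, into \<open>1/4\<close>.\<close>
  define w where "w = root 3 (1 / (12720 * l * L))"
  have lL: "l * L \<ge> 1" using mult_mono[of 1 l 1 L] l L by simp
  have w: "w > 0" using l L by (simp add: w_def)
  have w3: "w ^ 3 = 1 / (12720 * l * L)" using lL l L unfolding w_def by (intro real_root_pow_pos2) auto
  have "w ^ 3 \<le> 1 ^ 3" unfolding w3 using lL by (auto simp: divide_le_eq mult_ac)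
  then have "w \<le> 1" by (rule power_le_imp_le_base[of _ 2, simplified]) simp
  then have wL: "w \<le> L" using L by simp
  define M where "M = 2 * l * L"
  have M: "M > 0" using l L by (simp add: M_def)
  define S where "S x = M / w * bump (x / w)" for x
  define S' where "S' x = M / w\<^sup>2 * bump' (x / w)" for x
  have S_out: "S x = 0" "S' x = 0" if "\<bar>x\<bar> \<ge> w" for x
    using that w by (auto simp: S_def S'_def bump_outside)
  have cS: "continuous_on A S" "continuous_on A S'" for A
    unfolding S_def S'_def using w by (auto intro!: continuous_intros)
  have S_deriv: "(S has_real_derivative S' x) (at x)" for x
    unfolding S_def S'_def
    by (rule derivative_eq_intros DERIV_chain2[OF bump_deriv] refl)+ (use w in \<open>auto simp: power2_eq_square\<close>)
  define \<psi> where "\<psi> x = 2 * (S x - l)" for x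
  have c\<psi>: "continuous_on A \<psi>" for A unfolding \<psi>_def by (intro continuous_intros cS)
  define \<phi> where "\<phi> x = integral {-L..x} \<psi>" for x
  have SI: "(S has_integral M) {-L..L}"
  proof -
    have "(S has_integral (M / w * w)) {-w..w}" unfolding S_def
      by (intro has_integral_mult_right bump_moments w)
    then have "(S has_integral M) {-w..w}" using w by simp
    then show ?thesis using integral_extend_zero[OF wL, of S] S_out(1)
      by (simp add: integral_unique has_integral_integrable)
  qed
  have absS: "((\<lambda>x. \<bar>S x\<bar>) has_integral integral {-w..w} (\<lambda>x. \<bar>S x\<bar>)) {-L..L}"
    by (rule integral_extend_zero[OF wL]) (auto intro!: integrable_continuous_real continuous_intros cS S_out)
  have "\<bar>S x\<bar> \<le> M / w * (15/2)" for x
    unfolding S_def abs_mult using M w by (intro mult_mono bump_bounds) auto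
  then have "integral {-w..w} (\<lambda>x. \<bar>S x\<bar>) \<le> 2 * w * (M / w * (15/2))"
    by (intro integral_le_const continuous_intros cS) (use w in auto)
  also have "\<dots> = 30 * l * L" using w by (simp add: M_def)
  finally have absS_le: "integral {-w..w} (\<lambda>x. \<bar>S x\<bar>) \<le> 30 * l * L" .
  have \<phi>_bound: "\<bar>\<phi> x\<bar> \<le> 64 * l * L" if x: "x \<in> {-L..L}" for x
  proof -
    have i: "(\<lambda>x. \<bar>\<psi> x\<bar>) integrable_on {a..b}" for a b
      by (intro integrable_continuous_real continuous_intros c\<psi>)
    have "\<bar>\<phi> x\<bar> \<le> integral {-L..x} (\<lambda>x. \<bar>\<psi> x\<bar>)" unfolding \<phi>_def
      using integral_norm_bound_integral[of \<psi> "{-L..x}" "\<lambda>x. \<bar>\<psi> x\<bar>"] i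
      by (auto intro: integrable_continuous_real c\<psi>)
    also have "\<dots> \<le> integral {-L..L} (\<lambda>x. \<bar>\<psi> x\<bar>)"
      by (rule integral_subset_le) (use x i in auto)
    also have "\<dots> \<le> 2 * integral {-w..w} (\<lambda>x. \<bar>S x\<bar>) + (L - (-L)) * (2 * l)"
    proof (rule has_integral_le[OF integrable_integral[OF i]])
      show "((\<lambda>x. 2 * \<bar>S x\<bar> + 2 * l) has_integral
          2 * integral {-w..w} (\<lambda>x. \<bar>S x\<bar>) + (L - (-L)) * (2 * l)) {-L..L}"
        using has_integral_const_real[of "2 * l" "-L" L] L
        by (intro has_integral_add has_integral_mult_right absS) auto
    qed (use l in \<open>auto simp: \<psi>_def abs_le_iff\<close>)
    also have "\<dots> \<le> 64 * l * L" using absS_le by (simp add: algebra_simps)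
    finally show ?thesis .
  qed
  have \<phi>_deriv: "(\<phi> has_real_derivative \<psi> x) (at x within {-L..L})" if "x \<in> {-L..L}" for x
    unfolding \<phi>_def by (rule integral_has_real_derivative[OF c\<psi> that])
  have c\<phi>: "continuous_on {-L..L} \<phi>" by (rule DERIV_continuous_on[OF \<phi>_deriv])
  have \<psi>_deriv: "(\<psi> has_real_derivative 2 * S' x) (at x within A)" for x A
    unfolding \<psi>_def by (rule derivative_eq_intros has_field_derivative_at_within[OF S_deriv] | simp)+
  have \<phi>_ends: "\<phi> L = \<phi> (-L)"
  proof -
    have "(\<psi> has_integral (2 * (M - (L - (-L)) * l))) {-L..L}" unfolding \<psi>_def
      using has_integral_const_real[of l "-L" L] L
      by (intro has_integral_mult_right has_integral_diff SI) auto
    then show ?thesis by (simp add: \<phi>_def M_def integral_unique)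
  qed
  have \<psi>_ends: "\<psi> L = \<psi> (-L)" using wL L by (simp add: \<psi>_def S_out)
  have P: "integral {-L..L} (\<lambda>x. (\<phi> x)\<^sup>2) \<le> 8192 * l\<^sup>2 * L ^ 3"
  proof -
    have "(\<phi> x)\<^sup>2 \<le> (64 * l * L)\<^sup>2" if "x \<in> {-L..L}" for x
      using power_mono[OF \<phi>_bound[OF that], of 2] by simp
    then have "integral {-L..L} (\<lambda>x. (\<phi> x)\<^sup>2) \<le> 2 * L * (64 * l * L)\<^sup>2"
      by (intro integral_le_const continuous_intros c\<phi>) (use L in auto)
    also have "\<dots> = 8192 * l\<^sup>2 * L ^ 3" by (simp add: power_mult_distrib eval_nat_numeral)
    finally show ?thesis .
  qed
  have R: "integral {-L..L} (\<lambda>x. (2 * S' x)\<^sup>2) \<le> 1017600000 * l ^ 3 * L ^ 3"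
  proof -
    have ext: "((\<lambda>x. (2 * S' x)\<^sup>2) has_integral integral {-w..w} (\<lambda>x. (2 * S' x)\<^sup>2)) {-L..L}"
      by (rule integral_extend_zero[OF wL])
        (auto intro!: integrable_continuous_real continuous_intros cS simp: S_out)
    have "\<bar>2 * S' x\<bar> \<le> 2 * (M / w\<^sup>2 * 50)" for x
      unfolding S'_def abs_mult using M w by (intro mult_mono bump_bounds) auto
    from power_mono[OF this abs_ge_zero, where n = 2]
    have "(2 * S' x)\<^sup>2 \<le> (2 * (M / w\<^sup>2 * 50))\<^sup>2" for x unfolding power2_abs .
    then have "integral {-w..w} (\<lambda>x. (2 * S' x)\<^sup>2) \<le> 2 * w * (2 * (M / w\<^sup>2 * 50))\<^sup>2"
      by (intro integral_le_const continuous_intros cS) (use w in auto)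
    also have "\<dots> = 20000 * M\<^sup>2 / w ^ 3" using w by (simp add: field_simps eval_nat_numeral)
    also have "\<dots> = 1017600000 * l ^ 3 * L ^ 3" unfolding w3 M_def
      by (simp add: power_mult_distrib eval_nat_numeral)
    finally show ?thesis unfolding integral_unique[OF ext] .
  qed
  have coer: "1/2 * integral {-L..L} (\<lambda>x. \<psi> x * (v x)\<^sup>2)
           \<le> - l * integral {-L..L} (\<lambda>x. (v x)\<^sup>2) + 1/4 * integral {-L..L} (\<lambda>x. (v2 x)\<^sup>2)"
    if v: "\<And>x. (v has_real_derivative v1 x) (at x)" and v1: "\<And>x. (v1 has_real_derivative v2 x) (at x)"
      and cv2: "continuous_on {-L..L} v2" and mean: "integral {-L..L} v = 0"
      and orth: "integral {-L..L} (\<lambda>x. \<psi> x * v x) = 0" for v v1 v2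
  proof -
    have cv: "continuous_on A v" for A using v by (meson DERIV_isCont continuous_at_imp_continuous_on)
    have split: "1/2 * integral {-L..L} (\<lambda>x. \<psi> x * g x)
        = M / w * integral {-w..w} (\<lambda>x. bump (x / w) * g x) - l * integral {-L..L} g"
      if cg: "\<And>A. continuous_on A g" for g
    proof -
      have "((\<lambda>x. S x * g x) has_integral integral {-w..w} (\<lambda>x. S x * g x)) {-L..L}"
        by (rule integral_extend_zero[OF wL])
          (auto intro!: integrable_continuous_real continuous_intros cS cg simp: S_out)
      moreover have "integral {-w..w} (\<lambda>x. S x * g x) = M / w * integral {-w..w} (\<lambda>x. bump (x / w) * g x)"
        by (simp add: S_def mult.assoc flip: integral_mult_right)
      ultimately have "((\<lambda>x. 2 * (S x * g x - l * g x)) has_integral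
          2 * (M / w * integral {-w..w} (\<lambda>x. bump (x / w) * g x) - l * integral {-L..L} g)) {-L..L}"
        by (intro has_integral_mult_right has_integral_diff integrable_integral integrable_continuous_real cg) auto
      then show ?thesis by (simp add: \<psi>_def integral_unique left_diff_distrib mult.assoc)
    qed
    have "integral {-w..w} (\<lambda>x. bump (x / w) * v x) = 0"
      using split[OF cv] mean orth M w by simp
    from bump_form_le[OF w v v1 continuous_on_subset[OF cv2] this]
    have "integral {-w..w} (\<lambda>x. bump (x / w) * (v x)\<^sup>2)
        \<le> 1590 * w ^ 4 * integral {-w..w} (\<lambda>x. (v2 x)\<^sup>2)" using wL by auto
    also have "\<dots> \<le> 1590 * w ^ 4 * integral {-L..L} (\<lambda>x. (v2 x)\<^sup>2)"
      by (intro mult_left_mono integral_subset_le)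
        (use wL w in \<open>auto intro!: integrable_continuous_real continuous_intros continuous_on_subset[OF cv2]\<close>)
    finally have "M / w * integral {-w..w} (\<lambda>x. bump (x / w) * (v x)\<^sup>2)
        \<le> M / w * (1590 * w ^ 4 * integral {-L..L} (\<lambda>x. (v2 x)\<^sup>2))"
      using M w by (intro mult_left_mono) auto
    also have "\<dots> = M * 1590 * w ^ 3 * integral {-L..L} (\<lambda>x. (v2 x)\<^sup>2)"
      using w by (simp add: eval_nat_numeral)
    also have "M * 1590 * w ^ 3 = 1/4" unfolding w3 M_def using l L by simp
    finally have "M / w * integral {-w..w} (\<lambda>x. bump (x / w) * (v x)\<^sup>2)
        \<le> 1/4 * integral {-L..L} (\<lambda>x. (v2 x)\<^sup>2)" .
    moreover have "1/2 * integral {-L..L} (\<lambda>x. \<psi> x * (v x)\<^sup>2)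
        = M / w * integral {-w..w} (\<lambda>x. bump (x / w) * (v x)\<^sup>2) - l * integral {-L..L} (\<lambda>x. (v x)\<^sup>2)"
      by (intro split continuous_intros cv)
    ultimately show ?thesis by linarith
  qed
  show thesis
    by (rule that[of \<phi> \<psi> "\<lambda>x. 2 * S' x"])
      (rule \<phi>_deriv \<psi>_deriv continuous_on_mult_left cS \<phi>_ends \<psi>_ends P R coer, assumption?)+
qed

section \<open>Dissipation of the distance to the profile\<close>

text \<open>
  Apart from \<open>- \<integral> v''^2\<close>, each of the terms \<open>v v''\<close>, \<open>\<phi> v''''\<close>, \<open>\<phi> v''\<close> and the quadratic form
  of \<open>\<phi>'\<close> costs at most \<open>1/4 \<integral> v''^2\<close>, so the second derivative is used up exactly.  The
  coefficient \<open>\<gamma> + 3\<close> is the sum of \<open>\<gamma>\<close>, of at most two units spent in Young's inequality, and of one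
  unit that remains for the decay.
\<close>

lemma energy_rate_le:
  fixes v v1 v2 v3 v4 \<phi> \<phi>1 \<phi>2 :: "real \<Rightarrow> real"
  assumes "\<gamma> \<ge> 0" "L \<ge> 0"
    and d: "\<And>x. (v has_real_derivative v1 x) (at x)" "\<And>x. (v1 has_real_derivative v2 x) (at x)"
      "\<And>x. (v2 has_real_derivative v3 x) (at x)" "\<And>x. (v3 has_real_derivative v4 x) (at x)"
    and c4: "continuous_on {-L..L} v4"
    and per: "v L = v (-L)" "v1 L = v1 (-L)" "v2 L = v2 (-L)" "v3 L = v3 (-L)"
    and d\<phi>: "\<And>x. x \<in> {-L..L} \<Longrightarrow> (\<phi> has_real_derivative \<phi>1 x) (at x within {-L..L})"
      "\<And>x. x \<in> {-L..L} \<Longrightarrow> (\<phi>1 has_real_derivative \<phi>2 x) (at x within {-L..L})"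
    and c\<phi>2: "continuous_on {-L..L} \<phi>2"
    and per\<phi>: "\<phi> L = \<phi> (-L)" "\<phi>1 L = \<phi>1 (-L)"
    and coer: "1/2 * integral {-L..L} (\<lambda>x. \<phi>1 x * (v x)\<^sup>2)
      \<le> - (\<gamma> + 3) * integral {-L..L} (\<lambda>x. (v x)\<^sup>2) + 1/4 * integral {-L..L} (\<lambda>x. (v2 x)\<^sup>2)"
  shows "integral {-L..L} (\<lambda>x. 2 * (v x - \<phi> x) * (- v4 x - v2 x + \<gamma> * v x + v x * v1 x))
    \<le> - integral {-L..L} (\<lambda>x. (v x - \<phi> x)\<^sup>2) + 2 * integral {-L..L} (\<lambda>x. (\<phi>2 x)\<^sup>2)
      + (4 + 2 * \<gamma>\<^sup>2) * integral {-L..L} (\<lambda>x. (\<phi> x)\<^sup>2)"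
proof -
  let ?I = "integral {-L..L} :: (real \<Rightarrow> real) \<Rightarrow> real"
  have cv: "continuous_on {-L..L} v" "continuous_on {-L..L} v1"
    "continuous_on {-L..L} v2" "continuous_on {-L..L} v3"
    by (rule DERIV_continuous_on, rule has_field_derivative_at_within, rule d)+
  have c\<phi>: "continuous_on {-L..L} \<phi>" "continuous_on {-L..L} \<phi>1"
    by (rule DERIV_continuous_on, erule d\<phi>)+
  note c = cv c\<phi> c4 c\<phi>2
  note dw = d[THEN has_field_derivative_at_within]
  have int: "(f has_integral ?I f) {-L..L}" if "continuous_on {-L..L} f" for f
    by (rule integrable_integral[OF integrable_continuous_real[OF that]])
  have le2: "?I f \<le> a * ?I g + b * ?I h" if "continuous_on {-L..L} f" "continuous_on {-L..L} g"
    "continuous_on {-L..L} h" "\<And>x. f x \<le> a * g x + b * h x" for f g h a b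
    by (rule has_integral_le[OF int[OF that(1)] has_integral_add[OF
      has_integral_mult_right[OF int[OF that(2)]] has_integral_mult_right[OF int[OF that(3)]]]]) (rule that(4))
  define X where "X = ?I (\<lambda>x. (v2 x)\<^sup>2)"
  define Y where "Y = ?I (\<lambda>x. (v x)\<^sup>2)"
  define P where "P = ?I (\<lambda>x. (\<phi> x)\<^sup>2)"
  define R where "R = ?I (\<lambda>x. (\<phi>2 x)\<^sup>2)"
  note defs = X_def Y_def P_def R_def
  have young: "p * q \<le> 1/4 * p\<^sup>2 + 1 * q\<^sup>2" "- (p * q) \<le> 1/4 * p\<^sup>2 + 1 * q\<^sup>2" for p q :: real
    using zero_le_power2[of "p / 2 - q"] zero_le_power2[of "p / 2 + q"]
    by (simp_all add: power2_eq_square algebra_simps)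
  have "?I (\<lambda>x. v4 x * v x) = - ?I (\<lambda>x. v3 x * v1 x)"
    by (rule integral_parts_periodic) (use \<open>L \<ge> 0\<close> dw c per in auto)
  moreover have "?I (\<lambda>x. v3 x * v1 x) = - ?I (\<lambda>x. v2 x * v2 x)"
    by (rule integral_parts_periodic) (use \<open>L \<ge> 0\<close> dw c per in auto)
  ultimately have i1: "?I (\<lambda>x. v4 x * v x) = X" by (simp add: X_def power2_eq_square)
  have i2: "?I (\<lambda>x. - (v2 x * v x)) \<le> 1/4 * X + 1 * Y"
    unfolding defs by (intro le2 continuous_intros c young)
  have i3: "?I (\<lambda>x. (v x)\<^sup>2 * v1 x) = 0"
  proof (rule integral_deriv_periodic)
    show "((\<lambda>x. (v x) ^ 3 / 3) has_real_derivative (v x)\<^sup>2 * v1 x) (at x within {-L..L})" for x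
      by (auto intro!: derivative_eq_intros dw)
  qed (use \<open>L \<ge> 0\<close> per in \<open>auto intro!: continuous_intros c\<close>)
  have "?I (\<lambda>x. v4 x * \<phi> x) = - ?I (\<lambda>x. v3 x * \<phi>1 x)"
    by (rule integral_parts_periodic) (use \<open>L \<ge> 0\<close> dw d\<phi> c per per\<phi> in auto)
  moreover have "?I (\<lambda>x. v3 x * \<phi>1 x) = - ?I (\<lambda>x. v2 x * \<phi>2 x)"
    by (rule integral_parts_periodic) (use \<open>L \<ge> 0\<close> dw d\<phi> c per per\<phi> in auto)
  moreover have "?I (\<lambda>x. v2 x * \<phi>2 x) \<le> 1/4 * X + 1 * R"
    unfolding defs by (intro le2 continuous_intros c young)
  ultimately have i4: "?I (\<lambda>x. v4 x * \<phi> x) \<le> 1/4 * X + R" by simp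
  have i5: "?I (\<lambda>x. v2 x * \<phi> x) \<le> 1/4 * X + 1 * P"
    unfolding defs by (intro le2 continuous_intros c young)
  have i6: "?I (\<lambda>x. - (v x * (\<gamma> * \<phi> x))) \<le> 1/4 * Y + \<gamma>\<^sup>2 * P"
    unfolding defs
  proof (intro le2 continuous_intros c)
    show "- (v x * (\<gamma> * \<phi> x)) \<le> 1/4 * (v x)\<^sup>2 + \<gamma>\<^sup>2 * (\<phi> x)\<^sup>2" for x
      using young(2)[of "v x" "\<gamma> * \<phi> x"] by (simp add: power_mult_distrib)
  qed
  have "?I (\<lambda>x. \<phi>1 x * (v x)\<^sup>2) = - ?I (\<lambda>x. \<phi> x * (2 * v x * v1 x))"
  proof (rule integral_parts_periodic)
    show "((\<lambda>x. (v x)\<^sup>2) has_real_derivative 2 * v x * v1 x) (at x within {-L..L})" for x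
      by (auto intro!: derivative_eq_intros dw)
  qed (use \<open>L \<ge> 0\<close> d\<phi> per per\<phi> in \<open>auto intro!: continuous_intros c\<close>)
  moreover have "?I (\<lambda>x. \<phi> x * (2 * v x * v1 x)) = 2 * ?I (\<lambda>x. \<phi> x * (v x * v1 x))"
    by (simp add: algebra_simps flip: integral_mult_right)
  ultimately have i7: "- ?I (\<lambda>x. \<phi> x * (v x * v1 x)) \<le> - (\<gamma> + 3) * Y + 1/4 * X"
    using coer by (simp add: X_def Y_def)
  have Y: "Y \<ge> 0" unfolding Y_def by (intro integral_nonneg integrable_continuous_real continuous_intros c) auto
  have expand: "2 * (v x - \<phi> x) * (- v4 x - v2 x + \<gamma> * v x + v x * v1 x)
      = 2 * (- (v4 x * v x) + - (v2 x * v x) + \<gamma> * (v x)\<^sup>2 + (v x)\<^sup>2 * v1 x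
        + v4 x * \<phi> x + v2 x * \<phi> x + - (v x * (\<gamma> * \<phi> x)) + - (\<phi> x * (v x * v1 x)))" for x
    by (simp add: power2_eq_square algebra_simps)
  have "((\<lambda>x. 2 * (v x - \<phi> x) * (- v4 x - v2 x + \<gamma> * v x + v x * v1 x)) has_integral
      2 * (- ?I (\<lambda>x. v4 x * v x) + ?I (\<lambda>x. - (v2 x * v x)) + \<gamma> * Y + ?I (\<lambda>x. (v x)\<^sup>2 * v1 x)
        + ?I (\<lambda>x. v4 x * \<phi> x) + ?I (\<lambda>x. v2 x * \<phi> x) + ?I (\<lambda>x. - (v x * (\<gamma> * \<phi> x)))
        + - ?I (\<lambda>x. \<phi> x * (v x * v1 x)))) {-L..L}" (is "(?f has_integral ?J) _")
    unfolding expand Y_def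
    by (intro has_integral_mult_right has_integral_add has_integral_diff has_integral_neg int continuous_intros c)
  then have "?I ?f = ?J" by (rule integral_unique)
  also have "\<dots> \<le> 2 * (- X + (1/4 * X + 1 * Y) + \<gamma> * Y + 0 + (1/4 * X + R) + (1/4 * X + 1 * P)
      + (1/4 * Y + \<gamma>\<^sup>2 * P) + (- (\<gamma> + 3) * Y + 1/4 * X))"
    unfolding i1 i3 by (intro mult_left_mono add_mono order_refl i2 i4 i5 i6 i7) simp
  also have "\<dots> \<le> - 2 * Y + 2 * R + (2 + 2 * \<gamma>\<^sup>2) * P" using Y by (simp add: algebra_simps)
  also have "\<dots> \<le> - ?I (\<lambda>x. (v x - \<phi> x)\<^sup>2) + 2 * R + (4 + 2 * \<gamma>\<^sup>2) * P"
  proof -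
    have "?I (\<lambda>x. (v x - \<phi> x)\<^sup>2) \<le> 2 * Y + 2 * P" unfolding defs
    proof (intro le2 continuous_intros c)
      show "(v x - \<phi> x)\<^sup>2 \<le> 2 * (v x)\<^sup>2 + 2 * (\<phi> x)\<^sup>2" for x
        using zero_le_power2[of "v x + \<phi> x"] by (simp add: power2_eq_square algebra_simps)
    qed
    then show ?thesis by (simp add: algebra_simps)
  qed
  finally show ?thesis unfolding defs .
qed

section \<open>Comparison for a minimum over a parameter\<close>

text \<open>
  A Gronwall lemma for the minimum of \<open>G t s\<close> over \<open>s\<close>.  If the last time \<open>t0\<close> at which the
  minimum lies below the barrier \<open>B\<close> came before \<open>t\<close>, then at a minimiser \<open>s\<close> the function
  \<open>G\<close> with this \<open>s\<close> frozen would stay below \<open>B\<close> for a little longer.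
  Differentiability is needed only with \<open>s\<close> frozen, and only where the minimum touches the barrier.
\<close>

lemma envelope_comparison:
  fixes G :: "real \<Rightarrow> real \<Rightarrow> real" and B B' :: "real \<Rightarrow> real"
  assumes pq: "p \<le> q"
    and cG: "continuous_on ({a..} \<times> {p..q}) (\<lambda>(t, s). G t s)"
    and B: "\<And>t. (B has_real_derivative B' t) (at t)"
    and touch: "\<And>t s. \<lbrakk>t \<ge> a; s \<in> {p..q}; \<And>s'. s' \<in> {p..q} \<Longrightarrow> G t s \<le> G t s'; G t s = B t\<rbrakk>
      \<Longrightarrow> \<exists>D<B' t. ((\<lambda>t. G t s) has_real_derivative D) (at t)"
    and init: "s0 \<in> {p..q}" "G a s0 \<le> B a"
    and "t \<ge> a"
  shows "\<exists>s\<in>{p..q}. G t s \<le> B t"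
proof (rule ccontr)
  assume neg: "\<not> ?thesis"
  have cB: "continuous_on A B" for A
    using B by (meson DERIV_isCont continuous_at_imp_continuous_on)
  \<comment> \<open>Projecting the compact set \<open>K\<close> to the time axis shows that the last good time is attained.\<close>
  define K where "K = {z \<in> {a..t} \<times> {p..q}. (case z of (t, s) \<Rightarrow> G t s) \<le> B (fst z)}"
  have "closed K" unfolding K_def
    by (intro continuous_on_closed_Collect_le continuous_on_subset[OF cG]
        continuous_on_compose2[OF cB[of UNIV]] continuous_intros closed_Times) auto
  moreover have "K = ({a..t} \<times> {p..q}) \<inter> K" by (auto simp: K_def)
  moreover have "compact ({a..t} \<times> {p..q})" by (intro compact_Times) auto
  ultimately have "compact K" by (metis compact_Int_closed)
  then have "compact (fst ` K)" by (intro compact_continuous_image continuous_intros)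
  moreover have "a \<in> fst ` K" using init \<open>t \<ge> a\<close>
    by (intro image_eqI[of _ _ "(a, s0)"]) (auto simp: K_def)
  ultimately obtain t0 where t0: "t0 \<in> fst ` K" and t0_max: "\<And>t'. t' \<in> fst ` K \<Longrightarrow> t' \<le> t0"
    using compact_attains_sup[of "fst ` K"] by auto
  then obtain s1 where s1: "s1 \<in> {p..q}" "G t0 s1 \<le> B t0" and t0_bd: "a \<le> t0" "t0 \<le> t"
    by (auto simp: K_def)
  have "t0 < t" using s1 neg t0_bd by (cases "t0 = t") auto
  have "continuous_on {p..q} (\<lambda>s. case (t0, s) of (t, s) \<Rightarrow> G t s)"
    by (rule continuous_on_compose2[OF cG]) (use t0_bd in \<open>auto intro!: continuous_intros\<close>)
  then obtain s where s: "s \<in> {p..q}" and s_min: "\<And>s'. s' \<in> {p..q} \<Longrightarrow> G t0 s \<le> G t0 s'"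
    using continuous_attains_inf[of "{p..q}" "G t0"] pq by auto
  have le: "G t0 s \<le> B t0" using s_min[OF s1(1)] s1(2) by simp
  have "\<exists>d>0. \<forall>h>0. h < d \<longrightarrow> G (t0 + h) s \<le> B (t0 + h)"
  proof (cases "G t0 s = B t0")
    case True
    then obtain D where D: "D < B' t0" "((\<lambda>t. G t s) has_real_derivative D) (at t0)"
      using touch[OF t0_bd(1) s s_min] by blast
    from DERIV_neg_dec_right[OF DERIV_diff[OF D(2) B]] D(1)
    obtain d where "d > 0" "\<And>h. 0 < h \<Longrightarrow> h < d \<Longrightarrow> G (t0 + h) s - B (t0 + h) < G t0 s - B t0"
      by auto
    then show ?thesis using True by (intro exI[of _ d]) (auto simp: less_imp_le)
  next
    case False
    have "continuous_on {a..} (\<lambda>t. (case (t, s) of (t, s) \<Rightarrow> G t s) - B t)"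
      by (intro continuous_on_diff cB continuous_on_compose2[OF cG] continuous_intros) (use s in auto)
    then have "continuous_on {a..} (\<lambda>t. G t s - B t)" by simp
    from this[unfolded continuous_on_iff, rule_format, of t0 "B t0 - G t0 s"]
    obtain d where d: "d > 0" "\<And>x. x \<ge> a \<Longrightarrow> dist x t0 < d
        \<Longrightarrow> dist (G x s - B x) (G t0 s - B t0) < B t0 - G t0 s"
      using False le t0_bd by auto
    have "G (t0 + h) s \<le> B (t0 + h)" if "0 < h" "h < d" for h
      using d(2)[of "t0 + h"] that t0_bd by (simp add: dist_real_def)
    then show ?thesis using d(1) by blast
  qed
  then obtain d where d: "d > 0" "\<And>h. 0 < h \<Longrightarrow> h < d \<Longrightarrow> G (t0 + h) s \<le> B (t0 + h)" by blast
  define h where "h = min (d / 2) (t - t0)"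
  have h: "0 < h" "h < d" "t0 + h \<le> t" using d(1) \<open>t0 < t\<close> by (auto simp: h_def)
  then have "(t0 + h, s) \<in> K" using d(2)[of h] s t0_bd by (auto simp: K_def)
  then have "t0 + h \<in> fst ` K" by (rule image_eqI[rotated]) simp
  with t0_max[of "t0 + h"] h(1) show False by simp
qed

section \<open>Classical properties of solutions\<close>

lemma dx_0 [simp]: "dx 0 u x t = u x t"
  by (simp add: dx_def)

lemma dx_Suc: "dx (Suc k) u x t = deriv (\<lambda>y. dx k u y t) x"
  by (simp add: dx_def)

lemma dx_periodic:
  assumes "\<And>x. u (x + p) t = u x t"
  shows "dx k u (x + p) t = dx k u x t"
proof (induction k arbitrary: x)
  case (Suc k)
  have "deriv (\<lambda>y. dx k u y t) (x + p) = deriv (\<lambda>y. dx k u (y + p) t) x"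
    by (simp add: deriv_def DERIV_shift)
  then show ?case by (simp add: dx_Suc Suc)
qed (simp add: assms)

locale dKS_flow =
  fixes \<gamma> L :: real and u :: "real \<Rightarrow> real \<Rightarrow> real"
  assumes \<gamma>_nonneg: "\<gamma> \<ge> 0" and L_ge_1: "L \<ge> 1" and sol: "dKS_solution \<gamma> L u"
begin

abbreviation I :: "(real \<Rightarrow> real) \<Rightarrow> real" where "I \<equiv> integral {-L..L}"

text \<open>Writing \<open>u\<close> as its zeroth derivative lets the lemmas on \<^const>\<open>dx\<close> apply to every term.\<close>

definition rhs :: "real \<Rightarrow> real \<Rightarrow> real" where
  "rhs x t = - dx 4 u x t - dx 2 u x t + \<gamma> * dx 0 u x t + dx 0 u x t * dx 1 u x t"

lemma dx_deriv:
  assumes "t > 0" "k < 4"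
  shows "((\<lambda>x. dx k u (x + s) t) has_real_derivative dx (Suc k) u (x + s) t) (at x)"
proof -
  have "(\<lambda>y. dx k u y t) field_differentiable at (x + s)"
    using sol assms by (auto simp: dKS_solution_def)
  then have "((\<lambda>y. dx k u y t) has_real_derivative dx (Suc k) u (x + s) t) (at (x + s))"
    unfolding dx_Suc by (rule field_differentiable_derivI)
  then show ?thesis by (simp add: DERIV_shift)
qed

lemma dx_ends:
  assumes "t > 0"
  shows "dx k u (L + s) t = dx k u (- L + s) t"
proof -
  have "dx k u (- L + s + 2 * L) t = dx k u (- L + s) t"
    by (rule dx_periodic) (use sol assms in \<open>auto simp: dKS_solution_def\<close>)
  then show ?thesis by (simp add: algebra_simps)
qed

lemma dx_continuous:
  assumes "k \<le> 4" "continuous_on A f" "continuous_on A g" "\<And>z. z \<in> A \<Longrightarrow> g z > 0"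
  shows "continuous_on A (\<lambda>z. dx k u (f z) (g z))"
proof -
  have c: "continuous_on (UNIV \<times> {0<..}) (\<lambda>(x, t). dx k u x t)"
    using sol assms(1) by (auto simp: dKS_solution_def)
  have "continuous_on A (\<lambda>z. case (f z, g z) of (x, t) \<Rightarrow> dx k u x t)"
    by (rule continuous_on_compose2[OF c continuous_on_Pair[OF assms(2,3)]]) (use assms(4) in auto)
  then show ?thesis by simp
qed

lemma rhs_continuous:
  assumes "continuous_on A f" "continuous_on A g" "\<And>z. z \<in> A \<Longrightarrow> g z > 0"
  shows "continuous_on A (\<lambda>z. rhs (f z) (g z))"
  unfolding rhs_def by (intro continuous_intros dx_continuous assms) auto

lemma time_deriv:
  assumes "t > 0"
  shows "((\<lambda>t. dx 0 u x t) has_real_derivative rhs x t) (at t)"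
proof -
  have "(\<lambda>s. u x s) field_differentiable at t" and "dt u x t = rhs x t"
    using sol assms by (auto simp: dKS_solution_def rhs_def)
  then show ?thesis using field_differentiable_derivI[of "\<lambda>s. u x s" t] by (simp add: dt_def)
qed

lemmas dx_deriv_within = dx_deriv[THEN has_field_derivative_at_within]

lemma integral_rhs:
  assumes "t > 0"
  shows "I (\<lambda>x. rhs x t) = \<gamma> * I (\<lambda>x. dx 0 u x t)"
proof -
  have c: "continuous_on {-L..L} (\<lambda>x. dx k u x t)" if "k \<le> 4" for k
    by (intro dx_continuous continuous_intros that assms)
  have zero: "I (\<lambda>x. dx (Suc k) u x t) = 0" if "k < 4" for k
    by (rule integral_deriv_periodic[where f = "\<lambda>x. dx k u x t"])
      (use dx_deriv_within[OF assms that, of 0] dx_ends[OF assms, of k 0] c[of "Suc k"] that L_ge_1 in auto)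
  have nonlin: "I (\<lambda>x. dx 0 u x t * dx 1 u x t) = 0"
  proof (rule integral_deriv_periodic[where f = "\<lambda>x. (dx 0 u x t)\<^sup>2 / 2"])
    show "((\<lambda>x. (dx 0 u x t)\<^sup>2 / 2) has_real_derivative dx 0 u x t * dx 1 u x t) (at x within {-L..L})" for x
      using dx_deriv_within[OF assms, of 0 0 x "{-L..L}"] by (auto intro!: derivative_eq_intros)
  qed (use dx_ends[OF assms, of 0 0] c[of 0] c[of 1] L_ge_1 in \<open>auto intro!: continuous_intros\<close>)
  have "((\<lambda>x. rhs x t) has_integral
      (- I (\<lambda>x. dx 4 u x t) - I (\<lambda>x. dx 2 u x t) + \<gamma> * I (\<lambda>x. dx 0 u x t)
        + I (\<lambda>x. dx 0 u x t * dx 1 u x t))) {-L..L}"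
    unfolding rhs_def
    by (intro has_integral_add has_integral_diff has_integral_neg has_integral_mult_right
        integrable_integral integrable_continuous_real continuous_on_mult c) auto
  then show ?thesis using zero[of 3] zero[of 1] nonlin
    by (simp add: integral_unique eval_nat_numeral)
qed

text \<open>
  The solution is classical only for positive times, so the zero mean of the initial value has to be
  transported through the convergence in \<open>L2\<close>, which controls the mean on a bounded interval.
\<close>

lemma initial_mean_tendsto:
  assumes "(LINT x:{-L..L}|lebesgue. u x 0) = 0"
  shows "((\<lambda>t. I (\<lambda>x. dx 0 u x t)) \<longlongrightarrow> 0) (at_right 0)"
proof -
  let ?S = "{-L..L}"
  have L: "L > 0" using L_ge_1 by simp
  have m0: "set_borel_measurable lebesgue ?S (\<lambda>x. u x 0)"
    and sq0: "set_integrable lebesgue ?S (\<lambda>x. (u x 0)\<^sup>2)"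
    using sol by (auto simp: dKS_solution_def in_L2_def)
  have one: "set_integrable lebesgue ?S (\<lambda>x. 1 :: real)"
    by (intro absolutely_integrable_continuous_real continuous_intros)
  have i0: "set_integrable lebesgue ?S (\<lambda>x. u x 0)"
  proof (rule set_integrable_bound[OF set_integral_add(1)[OF one sq0] m0], rule AE_I2, rule impI)
    show "norm (u x 0) \<le> norm (1 + (u x 0)\<^sup>2)" for x
      using zero_le_power2[of "\<bar>u x 0\<bar> - 1"] by (simp add: power2_diff)
  qed
  have le: "\<bar>I (\<lambda>x. dx 0 u x t)\<bar> \<le> sqrt (2 * L) * L2_norm L (\<lambda>x. u x t - u x 0)" if "t > 0" for t
  proof -
    let ?f = "\<lambda>x. u x t - u x 0"
    have c: "continuous_on ?S (\<lambda>x. u x t)"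
      using dx_continuous[of 0 ?S "\<lambda>x. x" "\<lambda>_. t"] that by (simp add: continuous_intros)
    have it: "set_integrable lebesgue ?S (\<lambda>x. u x t)" "set_integrable lebesgue ?S (\<lambda>x. (u x t)\<^sup>2)"
      by (intro absolutely_integrable_continuous_real continuous_intros c)+
    have f: "set_integrable lebesgue ?S ?f" by (rule set_integral_diff(1)[OF it(1) i0])
    have meas: "set_borel_measurable lebesgue ?S (\<lambda>x. (?f x)\<^sup>2)"
    proof -
      have "(\<lambda>x. (indicator ?S x *\<^sub>R ?f x)\<^sup>2) \<in> borel_measurable lebesgue"
        using f[unfolded set_integrable_def, THEN borel_measurable_integrable]
        by (rule borel_measurable_power)
      also have "(\<lambda>x. (indicator ?S x *\<^sub>R ?f x)\<^sup>2) = (\<lambda>x. indicator ?S x *\<^sub>R (?f x)\<^sup>2)"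
        by (auto simp: fun_eq_iff indicator_def)
      finally show ?thesis unfolding set_borel_measurable_def .
    qed
    have dom: "set_integrable lebesgue ?S (\<lambda>x. 2 * (u x t)\<^sup>2 + 2 * (u x 0)\<^sup>2)"
      by (intro set_integral_add(1) set_integrable_mult_right it(2) sq0)
    have f2: "set_integrable lebesgue ?S (\<lambda>x. (?f x)\<^sup>2)"
    proof (rule set_integrable_bound[OF dom meas], rule AE_I2, rule impI)
      fix x
      have "(?f x)\<^sup>2 \<le> 2 * (u x t)\<^sup>2 + 2 * (u x 0)\<^sup>2"
        using zero_le_power2[of "u x t + u x 0"] by (simp add: power2_eq_square algebra_simps)
      then show "norm ((?f x)\<^sup>2) \<le> norm (2 * (u x t)\<^sup>2 + 2 * (u x 0)\<^sup>2)" by simp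
    qed
    have "I (\<lambda>x. dx 0 u x t) = (LINT x:?S|lebesgue. ?f x)"
      using set_lebesgue_integral_eq_integral(2)[OF it(1)] assms
      by (simp add: set_integral_diff(2)[OF it(1) i0])
    then have "\<bar>I (\<lambda>x. dx 0 u x t)\<bar> = sqrt ((LINT x:?S|lebesgue. ?f x)\<^sup>2)" by simp
    also have "\<dots> \<le> sqrt (2 * L * (LINT x:?S|lebesgue. (?f x)\<^sup>2))"
      by (intro real_sqrt_le_mono set_integral_power2_le f f2 L)
    finally show ?thesis by (simp add: L2_norm_def real_sqrt_mult)
  qed
  have "((\<lambda>t. sqrt (2 * L) * L2_norm L (\<lambda>x. u x t - u x 0)) \<longlongrightarrow> sqrt (2 * L) * 0) (at_right 0)"
    using sol by (intro tendsto_mult tendsto_const) (auto simp: dKS_solution_def)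
  then have lim: "((\<lambda>t. sqrt (2 * L) * L2_norm L (\<lambda>x. u x t - u x 0)) \<longlongrightarrow> 0) (at_right 0)"
    by simp
  show ?thesis
  proof (rule Lim_null_comparison[OF _ lim], rule eventually_mono[OF eventually_at_right_less])
    show "norm (I (\<lambda>x. dx 0 u x t)) \<le> sqrt (2 * L) * L2_norm L (\<lambda>x. u x t - u x 0)"
      if "0 < t" for t
      using le[OF that] by (simp only: real_norm_def)
  qed
qed

text \<open>The mean solves \<open>m' = \<gamma> m\<close>, hence is a multiple of \<open>exp (\<gamma> t)\<close>; the initial limit makes the multiple vanish.\<close>

lemma mean_zero:
  assumes "(LINT x:{-L..L}|lebesgue. u x 0) = 0" and "t > 0"
  shows "I (\<lambda>x. dx 0 u x t) = 0"
proof -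
  define m where "m t = I (\<lambda>x. dx 0 u x t)" for t
  have m: "(m has_real_derivative \<gamma> * m t) (at t)" if "t > 0" for t
  proof -
    have "((\<lambda>t. I (\<lambda>x. dx 0 u x t)) has_real_derivative I (\<lambda>x. rhs x t)) (at t)"
    proof (rule DERIV_integral_param[where U = "{0<..}"])
      show "continuous_on {-L..L} (\<lambda>x. dx 0 u x t)" if "t \<in> {0<..}" for t
        by (intro dx_continuous continuous_intros) (use that in auto)
      show "continuous_on ({0<..} \<times> {-L..L}) (\<lambda>(t, x). rhs x t)"
        unfolding case_prod_beta by (intro rhs_continuous continuous_intros) auto
    qed (use that time_deriv in auto)
    then show ?thesis unfolding integral_rhs[OF that] m_def .
  qed
  have "((\<lambda>t. m t * exp (- \<gamma> * t)) has_real_derivative 0) (at t within {0<..})" if "t \<in> {0<..}" for t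
  proof -
    have e: "((\<lambda>t. exp (- \<gamma> * t)) has_real_derivative exp (- \<gamma> * t) * - \<gamma>) (at t)"
      by (rule derivative_eq_intros refl | simp)+
    have "t > 0" using that by simp
    from has_field_derivative_at_within[OF DERIV_mult[OF m[OF this] e], of "{0<..}"]
    show ?thesis by (simp add: mult_ac)
  qed
  then have "\<exists>c. \<forall>t\<in>{0<..}. m t * exp (- \<gamma> * t) = c"
    by (rule has_field_derivative_zero_constant[OF convex_real_interval(3)])
  then obtain c where "\<forall>t\<in>{0<..}. m t * exp (- \<gamma> * t) = c" ..
  then have c: "\<And>t. t > 0 \<Longrightarrow> m t * exp (- \<gamma> * t) = c" by simp
  have "((\<lambda>t. m t * exp (- \<gamma> * t)) \<longlongrightarrow> 0 * exp (- \<gamma> * 0)) (at_right 0)"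
    unfolding m_def by (intro tendsto_mult initial_mean_tendsto assms(1) tendsto_intros)
  moreover have "((\<lambda>t. m t * exp (- \<gamma> * t)) \<longlongrightarrow> c) (at_right 0)"
    by (rule tendsto_eventually, rule eventually_mono[OF eventually_at_right_less]) (rule c)
  ultimately have "0 * exp (- \<gamma> * 0) = c" by (rule tendsto_unique[OF trivial_limit_at_right_real])
  then have "c = 0" by simp
  then show ?thesis using c[OF assms(2)] by (simp add: m_def)
qed

lemma L2_norm_sq_shift:
  assumes "t > 0"
  shows "I (\<lambda>x. (dx 0 u (x + s) t)\<^sup>2) = I (\<lambda>x. (dx 0 u x t)\<^sup>2)"
proof (rule integral_periodic_shift[where g = "\<lambda>x. (dx 0 u x t)\<^sup>2"])
  show "((\<lambda>x. (dx 0 u x t)\<^sup>2) has_real_derivative 2 * dx 0 u x t * dx 1 u x t) (at x)" for x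
    using dx_deriv[OF assms, of 0 0 x] by (auto intro!: derivative_eq_intros)
  show "continuous_on UNIV (\<lambda>x. 2 * dx 0 u x t * dx 1 u x t)"
    by (intro continuous_intros dx_continuous assms) auto
  show "(dx 0 u (x + 2 * L) t)\<^sup>2 = (dx 0 u x t)\<^sup>2" for x
    using dx_ends[OF assms, of 0 "x + L"] by (simp add: algebra_simps)
qed (use L_ge_1 in simp)

lemma mean_zero_shift:
  assumes "(LINT x:{-L..L}|lebesgue. u x 0) = 0" and "t > 0"
  shows "I (\<lambda>x. dx 0 u (x + s) t) = 0"
proof -
  have "I (\<lambda>x. dx 0 u (x + s) t) = I (\<lambda>x. dx 0 u x t)"
  proof (rule integral_periodic_shift[where g = "\<lambda>x. dx 0 u x t"])
    show "((\<lambda>x. dx 0 u x t) has_real_derivative dx 1 u x t) (at x)" for x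
      using dx_deriv[OF assms(2), of 0 0 x] by simp
    show "continuous_on UNIV (\<lambda>x. dx 1 u x t)"
      by (intro continuous_intros dx_continuous assms) auto
    show "dx 0 u (x + 2 * L) t = dx 0 u x t" for x
      using dx_ends[OF assms(2), of 0 "x + L"] by (simp add: algebra_simps)
  qed (use L_ge_1 in simp)
  then show ?thesis using mean_zero[OF assms] by simp
qed

section \<open>The distance between translates and the profile\<close>

definition gap :: "(real \<Rightarrow> real) \<Rightarrow> real \<Rightarrow> real \<Rightarrow> real" where
  "gap \<phi> t s = I (\<lambda>x. (dx 0 u (x + s) t - \<phi> x)\<^sup>2)"

lemma gap_time_deriv:
  assumes "t > 0" and c\<phi>: "continuous_on {-L..L} \<phi>"
  shows "((\<lambda>t. gap \<phi> t s) has_real_derivative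
    I (\<lambda>x. 2 * (dx 0 u (x + s) t - \<phi> x) * rhs (x + s) t)) (at t)"
  unfolding gap_def
proof (rule DERIV_integral_param[where U = "{0<..}"])
  show "((\<lambda>t. (dx 0 u (x + s) t - \<phi> x)\<^sup>2) has_real_derivative
      2 * (dx 0 u (x + s) t - \<phi> x) * rhs (x + s) t) (at t)" if "t \<in> {0<..}" for t x
    using time_deriv[of t "x + s"] that by (auto intro!: derivative_eq_intros)
  show "continuous_on {-L..L} (\<lambda>x. (dx 0 u (x + s) t - \<phi> x)\<^sup>2)" if "t \<in> {0<..}" for t
    by (intro continuous_intros dx_continuous c\<phi>) (use that in auto)
  show "continuous_on ({0<..} \<times> {-L..L}) (\<lambda>(t, x). 2 * (dx 0 u (x + s) t - \<phi> x) * rhs (x + s) t)"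
    unfolding case_prod_beta
    by (intro continuous_intros dx_continuous rhs_continuous continuous_on_compose2[OF c\<phi>]) auto
qed (use assms in auto)

lemma gap_shift_deriv:
  assumes "t > 0" and c\<phi>: "continuous_on {-L..L} \<phi>"
  shows "((\<lambda>s. gap \<phi> t s) has_real_derivative
    I (\<lambda>x. 2 * (dx 0 u (x + s) t - \<phi> x) * dx 1 u (x + s) t)) (at s)"
  unfolding gap_def
proof (rule DERIV_integral_param[where U = UNIV])
  show "((\<lambda>s. (dx 0 u (x + s) t - \<phi> x)\<^sup>2) has_real_derivative
      2 * (dx 0 u (x + s) t - \<phi> x) * dx 1 u (x + s) t) (at s)" for s x
    using dx_deriv[OF assms(1), of 0 x s] by (auto intro!: derivative_eq_intros simp: add.commute)
  show "continuous_on {-L..L} (\<lambda>x. (dx 0 u (x + s) t - \<phi> x)\<^sup>2)" for s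
    by (intro continuous_intros dx_continuous c\<phi>) (use assms in auto)
  show "continuous_on (UNIV \<times> {-L..L}) (\<lambda>(s, x). 2 * (dx 0 u (x + s) t - \<phi> x) * dx 1 u (x + s) t)"
    unfolding case_prod_beta
    by (intro continuous_intros dx_continuous continuous_on_compose2[OF c\<phi>]) (use assms in auto)
qed auto

lemma gap_continuous:
  assumes c\<phi>: "continuous_on {-L..L} \<phi>"
  shows "continuous_on ({1..} \<times> {0..2 * L}) (\<lambda>(t, s). gap \<phi> t s)"
proof -
  have "continuous_on ({1..} \<times> {0..2 * L}) (\<lambda>z. integral (cbox (-L) L) (\<lambda>x. (dx 0 u (x + snd z) (fst z) - \<phi> x)\<^sup>2))"
    by (rule integral_continuous_on_param, unfold case_prod_beta)
      (intro continuous_intros dx_continuous continuous_on_compose2[OF c\<phi>], auto)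
  then show ?thesis by (simp add: gap_def case_prod_beta)
qed

lemma gap_periodic:
  assumes "t > 0"
  shows "gap \<phi> t (s + 2 * L) = gap \<phi> t s"
proof -
  have "dx 0 u (x + (s + 2 * L)) t = dx 0 u (x + s) t" for x
    using dx_ends[OF assms, of 0 "x + s + L"] by (simp add: algebra_simps)
  then show ?thesis by (simp add: gap_def)
qed

text \<open>
  Stationarity under translation: the \<open>s\<close>-derivative is \<open>2 \<integral> (v - \<phi>) v'\<close>, in which
  \<open>\<integral> v v'\<close> vanishes by periodicity and \<open>\<phi> v'\<close> is integrated by parts.
\<close>

lemma gap_critical:
  assumes "t > 0"
    and \<phi>: "\<And>x. x \<in> {-L..L} \<Longrightarrow> (\<phi> has_real_derivative \<phi>1 x) (at x within {-L..L})"
    and c\<phi>1: "continuous_on {-L..L} \<phi>1" and per: "\<phi> L = \<phi> (-L)"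
    and min: "\<And>s'. gap \<phi> t s \<le> gap \<phi> t s'"
  shows "I (\<lambda>x. \<phi>1 x * dx 0 u (x + s) t) = 0"
proof -
  have c\<phi>: "continuous_on {-L..L} \<phi>" by (rule DERIV_continuous_on[OF \<phi>])
  have c: "continuous_on {-L..L} (\<lambda>x. dx k u (x + s) t)" if "k \<le> 4" for k
    by (intro dx_continuous continuous_intros that assms(1))
  have L: "- L \<le> L" using L_ge_1 by simp
  have d: "((\<lambda>x. dx 0 u (x + s) t) has_real_derivative dx 1 u (x + s) t) (at x within {-L..L})" for x
    using dx_deriv_within[OF assms(1), of 0] by simp
  have "I (\<lambda>x. 2 * (dx 0 u (x + s) t - \<phi> x) * dx 1 u (x + s) t) = 0"
    by (rule DERIV_local_min[OF gap_shift_deriv[OF assms(1) c\<phi>], of 1]) (use min in auto)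
  moreover have "((\<lambda>x. 2 * (dx 0 u (x + s) t - \<phi> x) * dx 1 u (x + s) t) has_integral
      2 * (I (\<lambda>x. dx 0 u (x + s) t * dx 1 u (x + s) t) - I (\<lambda>x. \<phi> x * dx 1 u (x + s) t))) {-L..L}"
    unfolding mult.assoc left_diff_distrib
    by (intro has_integral_mult_right has_integral_diff integrable_integral integrable_continuous_real
        continuous_on_mult c c\<phi>) auto
  moreover have "I (\<lambda>x. dx 0 u (x + s) t * dx 1 u (x + s) t) = 0"
  proof (rule integral_deriv_periodic[OF L])
    show "((\<lambda>x. (dx 0 u (x + s) t)\<^sup>2 / 2) has_real_derivative dx 0 u (x + s) t * dx 1 u (x + s) t)
        (at x within {-L..L})" for x
      by (rule derivative_eq_intros d refl | simp)+
    show "continuous_on {-L..L} (\<lambda>x. dx 0 u (x + s) t * dx 1 u (x + s) t)"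
      by (intro continuous_on_mult c) auto
    show "(dx 0 u (L + s) t)\<^sup>2 / 2 = (dx 0 u (- L + s) t)\<^sup>2 / 2" by (simp only: dx_ends[OF assms(1)])
  qed
  moreover have "I (\<lambda>x. \<phi>1 x * dx 0 u (x + s) t) = - I (\<lambda>x. \<phi> x * dx 1 u (x + s) t)"
  proof (rule integral_parts_periodic[OF L \<phi> d c\<phi>1])
    show "continuous_on {-L..L} (\<lambda>x. dx 1 u (x + s) t)" by (rule c) simp
    show "\<phi> L * dx 0 u (L + s) t = \<phi> (- L) * dx 0 u (- L + s) t" by (simp only: dx_ends[OF assms(1)] per)
  qed
  ultimately show ?thesis by (simp only: integral_unique) simp
qed

section \<open>The absorbing ball\<close>

text \<open>
  With \<open>K\<close> the constant of \<open>energy_rate_le\<close>, the minimal gap \<open>G\<close> satisfies \<open>G' \<le> - G + K\<close>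
  at minimisers, and so it stays below the barrier \<open>B\<close>, which solves \<open>B' = - B + K + 1\<close>; the extra
  unit makes the comparison strict.
\<close>

lemma square_integral_eventually_le:
  assumes mean: "(LINT x:{-L..L}|lebesgue. u x 0) = 0"
  shows "\<forall>\<^sub>F t in at_top. I (\<lambda>x. (dx 0 u x t)\<^sup>2)
    \<le> (4070400000 * (\<gamma> + 3) ^ 3 + 16384 * (5 + 2 * \<gamma>\<^sup>2) * (\<gamma> + 3)\<^sup>2 + 3) * L ^ 3"
proof -
  have L: "L \<ge> 0" using L_ge_1 by simp
  have l: "\<gamma> + 3 \<ge> 1" using \<gamma>_nonneg by simp
  obtain \<phi> \<phi>1 \<phi>2 where
      \<phi>: "\<And>x. x \<in> {-L..L} \<Longrightarrow> (\<phi> has_real_derivative \<phi>1 x) (at x within {-L..L})"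
    and \<phi>1: "\<And>x. x \<in> {-L..L} \<Longrightarrow> (\<phi>1 has_real_derivative \<phi>2 x) (at x within {-L..L})"
    and c\<phi>2: "continuous_on {-L..L} \<phi>2"
    and per\<phi>: "\<phi> L = \<phi> (-L)" "\<phi>1 L = \<phi>1 (-L)"
    and P_le: "I (\<lambda>x. (\<phi> x)\<^sup>2) \<le> 8192 * (\<gamma> + 3)\<^sup>2 * L ^ 3"
    and R_le: "I (\<lambda>x. (\<phi>2 x)\<^sup>2) \<le> 1017600000 * (\<gamma> + 3) ^ 3 * L ^ 3"
    and coer: "\<And>v v1 v2. \<lbrakk>\<And>x. (v has_real_derivative v1 x) (at x); \<And>x. (v1 has_real_derivative v2 x) (at x);
         continuous_on {-L..L} v2; I v = 0; I (\<lambda>x. \<phi>1 x * v x) = 0\<rbrakk> \<Longrightarrow>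
         1/2 * I (\<lambda>x. \<phi>1 x * (v x)\<^sup>2) \<le> - (\<gamma> + 3) * I (\<lambda>x. (v x)\<^sup>2) + 1/4 * I (\<lambda>x. (v2 x)\<^sup>2)"
    by (fact background_profile[OF l L_ge_1])
  have c\<phi>: "continuous_on {-L..L} \<phi>" "continuous_on {-L..L} \<phi>1"
    by (rule DERIV_continuous_on, erule \<phi>, rule DERIV_continuous_on, erule \<phi>1)
  define P R where "P = I (\<lambda>x. (\<phi> x)\<^sup>2)" and "R = I (\<lambda>x. (\<phi>2 x)\<^sup>2)"
  define K where "K = 2 * R + (4 + 2 * \<gamma>\<^sup>2) * P"
  have PR0: "P \<ge> 0" "R \<ge> 0" unfolding P_def R_def
    by (intro integral_nonneg integrable_continuous_real continuous_intros c\<phi> c\<phi>2, simp)+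
  then have K0: "K \<ge> 0" by (simp add: K_def)
  define B where "B t = K + 1 + gap \<phi> 1 0 * exp (1 - t)" for t
  have B: "(B has_real_derivative (K + 1 - B t)) (at t)" for t
    unfolding B_def by (rule derivative_eq_intros refl | simp)+
  have dissipation: "\<exists>D<K + 1 - B t. ((\<lambda>t. gap \<phi> t s) has_real_derivative D) (at t)"
    if t: "t \<ge> 1" and min: "\<And>s'. s' \<in> {0..2 * L} \<Longrightarrow> gap \<phi> t s \<le> gap \<phi> t s'"
      and touch: "gap \<phi> t s = B t" for t s
  proof -
    have t0: "t > 0" using t by simp
    \<comment> \<open>A minimiser over one closed period is a minimiser over the line, so it is critical even at an endpoint.\<close>
    have "gap \<phi> t s \<le> gap \<phi> t s'" for s'
    proof -
      obtain s'' where "s'' \<in> {0..2 * L}" "gap \<phi> t s'' = gap \<phi> t s'"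
        using periodic_representative[of "2 * L" "gap \<phi> t" s'] gap_periodic[OF t0] L_ge_1 by auto
      then show ?thesis using min[of s''] by simp
    qed
    then have crit: "I (\<lambda>x. \<phi>1 x * dx 0 u (x + s) t) = 0"
      by (intro gap_critical[OF t0 \<phi> c\<phi>(2) per\<phi>(1)])
    have c: "continuous_on {-L..L} (\<lambda>x. dx k u (x + s) t)" if "k \<le> 4" for k
      by (intro dx_continuous continuous_intros that t0)
    have d: "((\<lambda>x. dx 0 u (x + s) t) has_real_derivative dx 1 u (x + s) t) (at x)"
      "((\<lambda>x. dx 1 u (x + s) t) has_real_derivative dx 2 u (x + s) t) (at x)"
      "((\<lambda>x. dx 2 u (x + s) t) has_real_derivative dx 3 u (x + s) t) (at x)"
      "((\<lambda>x. dx 3 u (x + s) t) has_real_derivative dx 4 u (x + s) t) (at x)" for x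
      using dx_deriv[OF t0, of 0] dx_deriv[OF t0, of 1] dx_deriv[OF t0, of 2] dx_deriv[OF t0, of 3]
      by (simp_all add: eval_nat_numeral)
    have "1/2 * I (\<lambda>x. \<phi>1 x * (dx 0 u (x + s) t)\<^sup>2)
        \<le> - (\<gamma> + 3) * I (\<lambda>x. (dx 0 u (x + s) t)\<^sup>2) + 1/4 * I (\<lambda>x. (dx 2 u (x + s) t)\<^sup>2)"
      by (rule coer[OF d(1,2) c mean_zero_shift[OF mean t0] crit]) simp
    from energy_rate_le[OF \<gamma>_nonneg L d c _ _ _ _ \<phi> \<phi>1 c\<phi>2 per\<phi> this]
    have "I (\<lambda>x. 2 * (dx 0 u (x + s) t - \<phi> x) * rhs (x + s) t) \<le> - gap \<phi> t s + K"
      unfolding gap_def K_def P_def R_def rhs_def by (simp add: dx_ends[OF t0] del: dx_0)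
    then show ?thesis using gap_time_deriv[OF t0 c\<phi>(1), of s] touch
      by (intro exI[of _ "I (\<lambda>x. 2 * (dx 0 u (x + s) t - \<phi> x) * rhs (x + s) t)"]) (simp del: dx_0)
  qed
  have bound: "\<exists>s\<in>{0..2 * L}. gap \<phi> t s \<le> B t" if "t \<ge> 1" for t
  proof (rule envelope_comparison[OF _ gap_continuous[OF c\<phi>(1)] B dissipation])
    show "gap \<phi> 1 0 \<le> B 1" using K0 by (simp add: B_def)
  qed (use that L in auto)
  have sq: "I (\<lambda>x. (dx 0 u x t)\<^sup>2) \<le> 2 * B t + 2 * P" if t1: "t \<ge> 1" for t
  proof -
    have t0: "t > 0" using t1 by simp
    obtain s where s: "gap \<phi> t s \<le> B t" using bound[OF t1] by blast
    have c: "continuous_on {-L..L} (\<lambda>x. dx 0 u (x + s) t)"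
      by (intro dx_continuous continuous_intros t0) simp
    have "I (\<lambda>x. (dx 0 u x t)\<^sup>2) = I (\<lambda>x. (dx 0 u (x + s) t)\<^sup>2)" by (rule L2_norm_sq_shift[OF t0, symmetric])
    also have "\<dots> \<le> 2 * gap \<phi> t s + 2 * P"
      unfolding gap_def P_def
    proof (rule has_integral_le[OF integrable_integral has_integral_add[OF
            has_integral_mult_right[OF integrable_integral] has_integral_mult_right[OF integrable_integral]]])
      show "(dx 0 u (x + s) t)\<^sup>2 \<le> 2 * (dx 0 u (x + s) t - \<phi> x)\<^sup>2 + 2 * (\<phi> x)\<^sup>2" for x
        using zero_le_power2[of "dx 0 u (x + s) t - 2 * \<phi> x"] by (simp add: power2_eq_square algebra_simps)
    qed (intro integrable_continuous_real continuous_intros c c\<phi>)+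
    finally show ?thesis using s by simp
  qed
  have "((\<lambda>t. exp (- t)) \<longlongrightarrow> (0::real)) at_top"
    by (rule filterlim_compose[OF exp_at_bot filterlim_uminus_at_bot_at_top])
  then have "((\<lambda>t. K + 1 + gap \<phi> 1 0 * (exp 1 * exp (- t))) \<longlongrightarrow> K + 1 + gap \<phi> 1 0 * (exp 1 * 0)) at_top"
    by (intro tendsto_intros)
  moreover have "B = (\<lambda>t. K + 1 + gap \<phi> 1 0 * (exp 1 * exp (- t)))"
    by (simp add: B_def fun_eq_iff flip: exp_add)
  ultimately have "(B \<longlongrightarrow> K + 1) at_top" by simp
  then have "\<forall>\<^sub>F t in at_top. B t < K + 3/2" by (rule order_tendstoD) simp
  then show ?thesis
  proof (rule eventually_elim2[OF _ eventually_ge_at_top[of 1]])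
    fix t assume t: "B t < K + 3/2" "1 \<le> t"
    have "(10 + 4 * \<gamma>\<^sup>2) * P \<le> (10 + 4 * \<gamma>\<^sup>2) * (8192 * (\<gamma> + 3)\<^sup>2 * L ^ 3)"
      by (intro mult_left_mono P_le[folded P_def]) simp
    moreover have "4 * R \<le> 4 * (1017600000 * (\<gamma> + 3) ^ 3 * L ^ 3)"
      by (intro mult_left_mono R_le[folded R_def]) simp
    moreover have "1 \<le> L ^ 3" using L_ge_1 by (rule one_le_power)
    moreover have "I (\<lambda>x. (dx 0 u x t)\<^sup>2) \<le> 4 * R + (10 + 4 * \<gamma>\<^sup>2) * P + 3"
      using sq[OF t(2)] t(1) by (simp add: K_def algebra_simps)
    ultimately have "I (\<lambda>x. (dx 0 u x t)\<^sup>2) \<le> 4 * (1017600000 * (\<gamma> + 3) ^ 3 * L ^ 3)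
        + (10 + 4 * \<gamma>\<^sup>2) * (8192 * (\<gamma> + 3)\<^sup>2 * L ^ 3) + 3 * L ^ 3" by linarith
    then show "I (\<lambda>x. (dx 0 u x t)\<^sup>2)
        \<le> (4070400000 * (\<gamma> + 3) ^ 3 + 16384 * (5 + 2 * \<gamma>\<^sup>2) * (\<gamma> + 3)\<^sup>2 + 3) * L ^ 3"
      by (simp add: algebra_simps del: dx_0)
  qed
qed

lemma L2_norm_eq:
  assumes "t > 0"
  shows "L2_norm L (\<lambda>x. u x t) = sqrt (I (\<lambda>x. (dx 0 u x t)\<^sup>2))"
proof -
  have "continuous_on {-L..L} (\<lambda>x. (dx 0 u x t)\<^sup>2)"
    by (intro continuous_intros dx_continuous assms) simp
  from set_lebesgue_integral_eq_integral(2)[OF absolutely_integrable_continuous_real[OF this]]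
  show ?thesis by (simp add: L2_norm_def)
qed

end

theorem mainTheorem1:
  fixes \<gamma> :: real
  assumes "\<gamma> \<ge> 0"
  shows "\<exists>C>0. \<exists>L0>0. \<forall>L\<ge>L0. \<forall>u :: real \<Rightarrow> real \<Rightarrow> real.
           dKS_solution \<gamma> L u \<longrightarrow> (LINT x:{-L..L}|lebesgue. u x 0) = 0 \<longrightarrow>
           Limsup at_top (\<lambda>t. ereal (L2_norm L (\<lambda>x. u x t))) \<le> ereal (C * L powr (3/2))"
proof -
  define A where "A = 4070400000 * (\<gamma> + 3) ^ 3 + 16384 * (5 + 2 * \<gamma>\<^sup>2) * (\<gamma> + 3)\<^sup>2 + 3"
  have A: "A > 0" unfolding A_def using assms by (intro add_nonneg_pos add_nonneg_nonneg mult_nonneg_nonneg) auto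
  have main: "Limsup at_top (\<lambda>t. ereal (L2_norm L (\<lambda>x. u x t))) \<le> ereal (sqrt A * L powr (3/2))"
    if L: "L \<ge> 1" and sol: "dKS_solution \<gamma> L u" and mean: "(LINT x:{-L..L}|lebesgue. u x 0) = 0" for L u
  proof -
    interpret dKS_flow \<gamma> L u by standard (fact assms L sol)+
    have "sqrt (L ^ 3) = L powr (3/2)"
      using L by (simp add: powr_half_sqrt[symmetric] powr_powr flip: powr_numeral)
    have "\<forall>\<^sub>F t in at_top. ereal (L2_norm L (\<lambda>x. u x t)) \<le> ereal (sqrt A * L powr (3/2))"
    proof (rule eventually_elim2[OF square_integral_eventually_le[OF mean] eventually_gt_at_top[of 0]])
      fix t :: real assume le: "I (\<lambda>x. (dx 0 u x t)\<^sup>2) \<le> (4070400000 * (\<gamma> + 3) ^ 3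
        + 16384 * (5 + 2 * \<gamma>\<^sup>2) * (\<gamma> + 3)\<^sup>2 + 3) * L ^ 3" and t: "0 < t"
      have "L2_norm L (\<lambda>x. u x t) \<le> sqrt (A * L ^ 3)"
        unfolding L2_norm_eq[OF t] A_def by (rule real_sqrt_le_mono[OF le])
      also have "\<dots> = sqrt A * L powr (3/2)" by (simp add: real_sqrt_mult \<open>sqrt (L ^ 3) = L powr (3/2)\<close>)
      finally show "ereal (L2_norm L (\<lambda>x. u x t)) \<le> ereal (sqrt A * L powr (3/2))" by simp
    qed
    then show ?thesis by (rule Limsup_bounded)
  qed
  have "sqrt A > 0" using A by simp
  then show ?thesis using main by (intro exI[of _ "sqrt A"] exI[of _ "1::real"] conjI) auto
qed

end
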